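(* Every finite $4$-nilpotent monoid $\mathbf{S}$ is finitely related with degree at most $|S|+1$.
   Context: For $d\in\mathbb{N}=\{1,2,\dots\}$, a semigroup $\mathbf{N}$ is $d$-nilpotent if $x_1\cdots x_d=y_1\cdots y_d$ for all $x_1,\dots,x_d,y_1,\dots,y_d\in N$. A $d$-nilpotent monoid is a $d$-nilpotent semigroup with an adjoined (new) identity element $1$. $|S|$ is the number of elements of the monoid. A semigroup term $t(x_1,\dots,x_n)$ is a (nonempty) word in the alphabet $x_1,\dots,x_n$; monoids are considered here as semigroups, i.e. with multiplication as the only operation. The $n$-ary term functions of $\mathbf{S}$ are the functions $t^{\mathbf{S}}:S^n\to S$ induced by terms $t(x_1,\dots,x_n)$ by evaluation. A function $f:S^n\to S$ preserves a relation $R\subseteq S^k$ if $f(r_1,\dots,r_n)\in R$ (with $f$ applied componentwise) whenever $r_1,\dots,r_n\in R$. $\mathbf{S}$ is finitely related if there are finitely many finitary relations $R_1,\dots,R_m$ on $S$ such that the finitary term functions of $\mathbf{S}$ are precisely the finitary functions on $S$ that preserve $R_1,\dots,R_m$. For $f:S^n\to S$ and $1\le i<j\le n$ let $f_{ij}:S^n\to S$, $f_{ij}(x_1,\dots,x_n)=f(x_1,\dots,x_{i-1},x_j,x_{i+1},\dots,x_n)$. The degree of a finite algebra $\mathbf{S}$ is the least $k\in\mathbb{N}$ such that for all $n>k$ every $f:S^n\to S$ all of whose $f_{ij}$ ($1\le i<j\le n$) are term functions of $\mathbf{S}$ is itself a term function of $\mathbf{S}$. (It is a known fact that a finite algebra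 is finitely related if and only if such a $k$ exists.) *)

theory Defs
  imports "HOL-Algebra.Group" "HOL-Library.FuncSet" "HOL-Library.Extended_Nat"
begin

text \<open>Semigroups are given by a carrier \<open>A\<close> and a binary operation \<open>m\<close>; a monoid \<open>S\<close> is viewed as
  the semigroup with carrier \<open>carrier S\<close> and operation \<open>mult S\<close>, so that \<open>\<one>\<close> is not part of the
  signature.\<close>

definition semigroup_on :: "'a set \<Rightarrow> ('a \<Rightarrow> 'a \<Rightarrow> 'a) \<Rightarrow> bool" where
  "semigroup_on A m \<longleftrightarrow>
     (\<forall>x\<in>A. \<forall>y\<in>A. m x y \<in> A) \<and>
     (\<forall>x\<in>A. \<forall>y\<in>A. \<forall>z\<in>A. m (m x y) z = m x (m y z))"

text \<open>The product of a nonempty list; the empty product is irrelevant.\<close>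

fun semigroup_prod :: "('a \<Rightarrow> 'a \<Rightarrow> 'a) \<Rightarrow> 'a list \<Rightarrow> 'a" where
  "semigroup_prod m [] = undefined"
| "semigroup_prod m [x] = x"
| "semigroup_prod m (x # y # ys) = m x (semigroup_prod m (y # ys))"

definition tuples :: "nat \<Rightarrow> 'a set \<Rightarrow> 'a list set" where
  "tuples n A = {xs. length xs = n \<and> set xs \<subseteq> A}"

definition nilpotent_semigroup :: "nat \<Rightarrow> 'a set \<Rightarrow> ('a \<Rightarrow> 'a \<Rightarrow> 'a) \<Rightarrow> bool" where
  "nilpotent_semigroup d A m \<longleftrightarrow>
     1 \<le> d \<and> semigroup_on A m \<and>
     (\<forall>xs\<in>tuples d A. \<forall>ys\<in>tuples d A. semigroup_prod m xs = semigroup_prod m ys)"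

text \<open>That \<open>\<one>\<close> is adjoined as a new element means that the remaining elements already
  form a \<open>d\<close>-nilpotent semigroup.\<close>

definition nilpotent_monoid :: "nat \<Rightarrow> ('a, 'b) monoid_scheme \<Rightarrow> bool" where
  "nilpotent_monoid d S \<longleftrightarrow>
     monoid S \<and>
     (\<exists>N. \<one>\<^bsub>S\<^esub> \<notin> N \<and> carrier S = insert \<one>\<^bsub>S\<^esub> N \<and> nilpotent_semigroup d N (mult S))"

text \<open>\<open>n\<close>-ary functions on \<open>A\<close> are extensional, so that equality of functions is
  equality on \<open>A\<^sup>n\<close>.\<close>

definition operations :: "nat \<Rightarrow> 'a set \<Rightarrow> ('a list \<Rightarrow> 'a) set" where
  "operations n A = (tuples n A \<rightarrow>\<^sub>E A)"

text \<open>A term is a nonempty word of variable indices (counted from \<open>0\<close>).\<close>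

definition terms :: "nat \<Rightarrow> nat list set" where
  "terms n = {w. w \<noteq> [] \<and> set w \<subseteq> {..<n}}"

definition term_function ::
    "'a set \<Rightarrow> ('a \<Rightarrow> 'a \<Rightarrow> 'a) \<Rightarrow> nat \<Rightarrow> nat list \<Rightarrow> 'a list \<Rightarrow> 'a" where
  "term_function A m n w = (\<lambda>xs\<in>tuples n A. semigroup_prod m (map (\<lambda>i. xs ! i) w))"

definition term_functions ::
    "'a set \<Rightarrow> ('a \<Rightarrow> 'a \<Rightarrow> 'a) \<Rightarrow> nat \<Rightarrow> ('a list \<Rightarrow> 'a) set" where
  "term_functions A m n = term_function A m n ` terms n"

text \<open>Here \<open>f\<close> has arity \<open>n\<close> and \<open>R\<close> has arity \<open>k\<close>.\<close>

definition preserves ::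
    "nat \<Rightarrow> ('a list \<Rightarrow> 'a) \<Rightarrow> nat \<Rightarrow> 'a list set \<Rightarrow> bool" where
  "preserves n f k R \<longleftrightarrow>
     (\<forall>rs\<in>tuples n R. map (\<lambda>i. f (map (\<lambda>r. r ! i) rs)) [0..<k] \<in> R)"

text \<open>Each relation is paired with its arity. All arities are positive.\<close>

definition finitely_related :: "'a set \<Rightarrow> ('a \<Rightarrow> 'a \<Rightarrow> 'a) \<Rightarrow> bool" where
  "finitely_related A m \<longleftrightarrow>
     (\<exists>Rs :: (nat \<times> 'a list set) set.
        finite Rs \<and>
        (\<forall>(k, R)\<in>Rs. 1 \<le> k \<and> R \<subseteq> tuples k A) \<and>
        (\<forall>n\<ge>1. term_functions A m n =
                 {f \<in> operations n A. \<forall>(k, R)\<in>Rs. preserves n f k R}))"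

text \<open>\<open>identify A n f i j\<close> is \<open>f\<^sub>i\<^sub>j\<close>: the argument at position \<open>i\<close> is replaced by the one at
  position \<open>j\<close>.\<close>

definition identify ::
    "'a set \<Rightarrow> nat \<Rightarrow> ('a list \<Rightarrow> 'a) \<Rightarrow> nat \<Rightarrow> nat \<Rightarrow> 'a list \<Rightarrow> 'a" where
  "identify A n f i j = (\<lambda>xs\<in>tuples n A. f (xs[i := xs ! j]))"

definition determined_by_minors :: "'a set \<Rightarrow> ('a \<Rightarrow> 'a \<Rightarrow> 'a) \<Rightarrow> nat \<Rightarrow> bool" where
  "determined_by_minors A m k \<longleftrightarrow>
     (\<forall>n>k. \<forall>f\<in>operations n A.
        (\<forall>i j. i < j \<and> j < n \<longrightarrow> identify A n f i j \<in> term_functions A m n) \<longrightarrow>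
        f \<in> term_functions A m n)"

text \<open>The degree is \<open>\<infinity>\<close> if no suitable \<open>k\<close> exists.\<close>

definition degree :: "'a set \<Rightarrow> ('a \<Rightarrow> 'a \<Rightarrow> 'a) \<Rightarrow> enat" where
  "degree A m = Inf (enat ` {k. 1 \<le> k \<and> determined_by_minors A m k})"

lemma degree_le_iff:
  "degree A m \<le> enat K \<longleftrightarrow> (\<exists>k. 1 \<le> k \<and> k \<le> K \<and> determined_by_minors A m k)"
  (is "_ \<longleftrightarrow> ?R")
proof
  let ?X = "enat ` {k. 1 \<le> k \<and> determined_by_minors A m k}"
  assume le: "degree A m \<le> enat K"
  have "?X \<noteq> {}"
  proof
    assume "?X = {}"
    with le show False by (simp only: degree_def Inf_enat_def) simp
  qed
  then have "degree A m \<in> ?X"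
    unfolding degree_def by (rule wellorder_InfI[OF ex_in_conv[THEN iffD2, THEN someI_ex]])
  with le show ?R by auto
next
  assume ?R
  then obtain k where "1 \<le> k" "k \<le> K" "determined_by_minors A m k" by blast
  then have "degree A m \<le> enat k"
    unfolding degree_def by (intro Inf_lower) auto
  also have "\<dots> \<le> enat K" using \<open>k \<le> K\<close> by simp
  finally show "degree A m \<le> enat K" .
qed

end

theory Submission
  imports Defs "HOL-Algebra.FiniteProduct"
begin

text \<open>
  Let \<open>N\<close> be the 4-nilpotent semigroup to which \<open>\<one>\<close> was adjoined, with zero \<open>z\<close>, and let \<open>f\<close> be
  an \<open>n\<close>-ary operation with \<open>n \<ge> |S| + 2\<close> all of whose minors are term functions. Evaluating a
  word at a point deletes the variables that take the value \<open>\<one>\<close>, and the result is \<open>z\<close> if at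
  least four letters remain. So a word acts on \<open>S\<close> only through its restrictions to sets of
  variables that leave at most three letters. Conversely, \<open>f\<close> restricted to a set \<open>Y\<close> of at most
  \<open>n - 2\<close> variables, the others being \<open>\<one>\<close>, is given by a word, because two of the other
  coordinates coincide and a minor applies (\<open>ex_represents\<close>). The task is to glue these local
  words into one.

  If some variable does not matter at all, then \<open>f\<close> is a renamed minor
  (\<open>ex_word_if_inessential\<close>); this uses that any \<open>n - 1\<close> coordinates contain a repetition. The
  case \<open>N = {z}\<close> is easy (\<open>word_if_N_trivial\<close>). In the remaining case \<open>f\<close> takes the value \<open>z\<close> at
  points with at least four coordinates in \<open>N\<close> (\<open>F_large_support\<close>), as every word does that
  contains all variables. The unary restrictions of \<open>f\<close> tell which variables are linear, that
  is, occur once. If \<open>S\<close> is not commutative, then the binary restrictions of \<open>f\<close> order the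
  linear variables, and the restrictions to three of them show that this order is transitive
  (\<open>precedes_trans\<close>); if \<open>S\<close> is commutative, then any order will do.

  Besides powers of a single variable, the remaining three-letter patterns have two copies of a
  variable \<open>x\<close> and one linear variable \<open>y\<close>. For every \<open>y\<close> the function \<open>f\<close> prescribes the number
  of copies of \<open>x\<close> in front of \<open>y\<close>, but only up to the identities of \<open>S\<close>, so there is a set \<open>C y
  \<subseteq> {0, 1, 2}\<close> of admissible numbers. A global word needs a choice of admissible numbers that is
  monotone along the order of the linear variables. By a Helly-type argument
  (\<open>monotone_selection\<close>) such a choice exists as soon as it exists for every three linear
  variables, where, if \<open>S\<close> is not commutative, it can be read off from the word for \<open>f\<close> on four
  variables; if \<open>S\<close> is commutative, then \<open>0\<close> is always admissible. Different variables \<open>x\<close> do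
  not interact, since two copies of each already make four letters; hence all of them can be
  inserted into the list of linear variables at the same time (\<open>ex_interleaving\<close>).

  This bounds the degree. Finite relatedness follows from any finite degree bound: if \<open>k\<close> is
  one, then the set of \<open>k\<close>-ary term functions, as a relation of arity \<open>|S|\<^sup>k\<close>, determines all
  term functions (\<open>finitely_related_if_determined_by_minors\<close>).\<close>

section \<open>Degree bounds imply finite relatedness\<close>

lemma semigroup_prod_closed:
  assumes "semigroup_on A m" "xs \<noteq> []" "set xs \<subseteq> A"
  shows "semigroup_prod m xs \<in> A"
  using assms(2,3)
proof (induction xs)
  case (Cons x xs)
  then show ?case using assms(1) by (cases xs) (auto simp: semigroup_on_def)
qed simp

lemma semigroup_prod_append:
  assumes "semigroup_on A m" "xs \<noteq> []" "ys \<noteq> []" "set xs \<subseteq> A" "set ys \<subseteq> A"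
  shows "semigroup_prod m (xs @ ys) = m (semigroup_prod m xs) (semigroup_prod m ys)"
  using assms(2,4)
proof (induction xs)
  case (Cons x xs)
  have cl: "semigroup_prod m ys \<in> A" using semigroup_prod_closed assms by blast
  show ?case
  proof (cases xs)
    case Nil
    with assms(3) show ?thesis by (cases ys) auto
  next
    case (Cons x' xs')
    have "semigroup_prod m xs \<in> A"
      using semigroup_prod_closed[OF assms(1), of xs] Cons.prems Cons by auto
    then show ?thesis
      using Cons Cons.IH Cons.prems assms(1) cl by (simp add: semigroup_on_def)
  qed
qed simp

text \<open>Substituting words into a word and then evaluating is the same as evaluating the
  substituted words first; this makes the term functions closed under composition.\<close>

lemma semigroup_prod_concat:
  assumes "semigroup_on A m" "w \<noteq> []" "\<And>i. i \<in> set w \<Longrightarrow> v i \<noteq> [] \<and> set (v i) \<subseteq> A"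
  shows "semigroup_prod m (concat (map v w)) = semigroup_prod m (map (\<lambda>i. semigroup_prod m (v i)) w)"
  using assms(2,3)
proof (induction w)
  case (Cons i w)
  show ?case
  proof (cases w)
    case (Cons j w')
    have "semigroup_prod m (concat (map v (i # w))) =
        m (semigroup_prod m (v i)) (semigroup_prod m (concat (map v w)))"
      using Cons.prems Cons by (simp, intro semigroup_prod_append[OF assms(1)]) auto
    also have "semigroup_prod m (concat (map v w)) =
        semigroup_prod m (map (\<lambda>i. semigroup_prod m (v i)) w)"
      using Cons.IH Cons.prems Cons by simp
    finally show ?thesis using Cons by simp
  qed simp
qed simp

lemma term_functions_subset_operations:
  assumes "semigroup_on A m"
  shows "term_functions A m n \<subseteq> operations n A"
proof
  fix f assume "f \<in> term_functions A m n"
  then obtain w where w: "w \<noteq> []" "set w \<subseteq> {..<n}" "f = term_function A m n w"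
    by (auto simp: term_functions_def terms_def)
  have "semigroup_prod m (map ((!) xs) w) \<in> A" if "xs \<in> tuples n A" for xs
    using that w by (intro semigroup_prod_closed[OF assms]) (auto simp: tuples_def subset_iff)
  with w show "f \<in> operations n A"
    by (auto simp: operations_def term_function_def)
qed

text \<open>Substitution of variables: variable \<open>l\<close> of \<open>f\<close> becomes variable \<open>\<sigma> l\<close>, so minors and the
  addition or removal of dummy variables are instances.\<close>

definition reindex :: "'a set \<Rightarrow> nat \<Rightarrow> nat \<Rightarrow> (nat \<Rightarrow> nat) \<Rightarrow> ('a list \<Rightarrow> 'a) \<Rightarrow> 'a list \<Rightarrow> 'a" where
  "reindex A n n' \<sigma> f = (\<lambda>ys\<in>tuples n' A. f (map (\<lambda>l. ys ! \<sigma> l) [0..<n]))"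

lemma map_nth_in_tuples:
  assumes "ys \<in> tuples n' A" "\<sigma> ` {..<n} \<subseteq> {..<n'}"
  shows "map (\<lambda>l. ys ! \<sigma> l) [0..<n] \<in> tuples n A"
  using assms by (auto simp: tuples_def subset_iff)

lemma column_in_tuples:
  assumes "rs \<in> tuples n R" "R \<subseteq> tuples k A" "i < k"
  shows "map (\<lambda>r. r ! i) rs \<in> tuples n A"
proof -
  have "r ! i \<in> A" if "r \<in> set rs" for r
  proof -
    have "length r = k" "set r \<subseteq> A" using assms(1,2) that by (auto simp: tuples_def)
    then show ?thesis using assms(3) nth_mem[of i r] by blast
  qed
  then show ?thesis using assms(1) by (auto simp: tuples_def)
qed

lemma reindex_operations:
  assumes "f \<in> operations n A" "\<sigma> ` {..<n} \<subseteq> {..<n'}"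
  shows "reindex A n n' \<sigma> f \<in> operations n' A"
  using assms(1) map_nth_in_tuples[OF _ assms(2), where A = A]
  by (auto simp: operations_def reindex_def PiE_def Pi_def)

lemma reindex_preserves:
  assumes "preserves n f k R" "\<sigma> ` {..<n} \<subseteq> {..<n'}" "R \<subseteq> tuples k A"
  shows "preserves n' (reindex A n n' \<sigma> f) k R"
  unfolding preserves_def
proof
  fix rs assume rs: "rs \<in> tuples n' R"
  let ?rs = "map (\<lambda>l. rs ! \<sigma> l) [0..<n]"
  have in': "?rs \<in> tuples n R" using map_nth_in_tuples[OF rs assms(2)] .
  have "reindex A n n' \<sigma> f (map (\<lambda>r. r ! i) rs) = f (map (\<lambda>r. r ! i) ?rs)" if "i < k" for i
  proof -
    have "map (\<lambda>r. r ! i) rs \<in> tuples n' A"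
      using column_in_tuples[OF rs assms(3) that] .
    moreover have "map (\<lambda>l. map (\<lambda>r. r ! i) rs ! \<sigma> l) [0..<n] = map (\<lambda>r. r ! i) ?rs"
      using rs assms(2) by (auto simp: tuples_def image_subset_iff)
    ultimately show ?thesis by (simp only: reindex_def restrict_apply if_True)
  qed
  then have "map (\<lambda>i. reindex A n n' \<sigma> f (map (\<lambda>r. r ! i) rs)) [0..<k] =
      map (\<lambda>i. f (map (\<lambda>r. r ! i) ?rs)) [0..<k]" by simp
  moreover have "map (\<lambda>i. f (map (\<lambda>r. r ! i) ?rs)) [0..<k] \<in> R"
    using assms(1) in' by (simp only: preserves_def)
  ultimately show "map (\<lambda>i. reindex A n n' \<sigma> f (map (\<lambda>r. r ! i) rs)) [0..<k] \<in> R"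
    by (simp only:)
qed

lemma reindex_term_functions:
  assumes "f \<in> term_functions A m n" "\<sigma> ` {..<n} \<subseteq> {..<n'}"
  shows "reindex A n n' \<sigma> f \<in> term_functions A m n'"
proof -
  obtain w where w: "w \<noteq> []" "set w \<subseteq> {..<n}" "f = term_function A m n w"
    using assms(1) by (auto simp: term_functions_def terms_def)
  have "reindex A n n' \<sigma> f ys = term_function A m n' (map \<sigma> w) ys" for ys
  proof (cases "ys \<in> tuples n' A")
    case True
    have "map (\<lambda>i. map (\<lambda>l. ys ! \<sigma> l) [0..<n] ! i) w = map (\<lambda>i. ys ! i) (map \<sigma> w)"
      using w(2) by auto
    then show ?thesis using True map_nth_in_tuples[OF True assms(2)]
      by (simp only: reindex_def term_function_def w(3) restrict_apply if_True)
  qed (simp add: reindex_def term_function_def)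
  moreover have "map \<sigma> w \<in> terms n'" using w assms(2) by (auto simp: terms_def)
  ultimately show ?thesis unfolding term_functions_def by blast
qed

text \<open>One relation suffices: the set of all \<open>k\<close>-ary term functions, written as tuples of values
  along an enumeration of \<open>A\<^sup>k\<close>. A function of arity at most \<open>k\<close> that preserves it is itself a
  member, as one sees by applying it to the projections. For larger arity \<open>n\<close>, each minor \<open>f\<^sub>i\<^sub>j\<close>
  is a function of \<open>n - 1\<close> variables that preserves the relation, hence a term function by
  induction, and the hypothesis on minors lifts this to \<open>f\<close>.\<close>

lemma finitely_related_if_determined_by_minors:
  assumes sg: "semigroup_on A m" and fin: "finite A" and ne: "A \<noteq> {}"
    and k: "1 \<le> k" and det: "determined_by_minors A m k"
  shows "finitely_related A m"
proof -
  have "finite (tuples k A)"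
    unfolding tuples_def using finite_lists_length_eq[OF fin, of k] by (simp add: conj_commute)
  then obtain ts where ts: "set ts = tuples k A" using finite_list by blast
  obtain a0 where "a0 \<in> A" using ne by blast
  then have "replicate k a0 \<in> set ts" by (auto simp: ts tuples_def)
  then have len: "1 \<le> length ts" by (cases ts) auto
  define R where "R = (\<lambda>t. map t ts) ` term_functions A m k"
  have Rsub: "R \<subseteq> tuples (length ts) A"
    using term_functions_subset_operations[OF sg, of k]
    by (fastforce simp: R_def tuples_def ts operations_def PiE_def Pi_def)
  have pres: "preserves n f (length ts) R" if f: "f \<in> term_functions A m n" for n f
    unfolding preserves_def
  proof
    fix rs assume rs: "rs \<in> tuples n R"
    obtain w where w: "w \<noteq> []" "set w \<subseteq> {..<n}" "f = term_function A m n w"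
      using f by (auto simp: term_functions_def terms_def)
    have "\<exists>v. v \<in> terms k \<and> rs ! j = map (term_function A m k v) ts" if "j < n" for j
    proof -
      have "rs ! j \<in> R" using rs that by (auto simp: tuples_def subset_iff)
      then show ?thesis by (auto simp: R_def term_functions_def)
    qed
    then obtain v where v: "\<And>j. j < n \<Longrightarrow> v j \<in> terms k"
      and rv: "\<And>j. j < n \<Longrightarrow> rs ! j = map (term_function A m k (v j)) ts" by metis
    let ?u = "concat (map v w)"
    \<comment> \<open>Compatibility of a term with the relation: substitute the words of the rows into its
      word.\<close>
    have u: "?u \<in> terms k"
    proof -
      obtain i w' where "w = i # w'" using w(1) by (cases w) auto
      then show ?thesis using v w by (fastforce simp: terms_def)
    qed
    have "f (map (\<lambda>r. r ! i) rs) = term_function A m k ?u (ts ! i)" if i: "i < length ts" for i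
    proof -
      let ?\<tau> = "ts ! i"
      have \<tau>: "?\<tau> \<in> tuples k A" using nth_mem[OF i] ts by simp
      have tup: "map (\<lambda>r. r ! i) rs \<in> tuples n A"
        using column_in_tuples[OF rs Rsub i] .
      have cols: "map (\<lambda>j. map (\<lambda>r. r ! i) rs ! j) w =
          map (\<lambda>j. semigroup_prod m (map (\<lambda>l. ?\<tau> ! l) (v j))) w"
      proof (rule map_cong[OF refl])
        fix j assume "j \<in> set w"
        then have j: "j < n" using w(2) by auto
        then have "map (\<lambda>r. r ! i) rs ! j = rs ! j ! i" using rs by (simp add: tuples_def)
        also have "\<dots> = term_function A m k (v j) ?\<tau>" using rv[OF j] i by simp
        finally show "map (\<lambda>r. r ! i) rs ! j = semigroup_prod m (map (\<lambda>l. ?\<tau> ! l) (v j))"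
          using \<tau> by (simp add: term_function_def)
      qed
      have "f (map (\<lambda>r. r ! i) rs) =
          semigroup_prod m (map (\<lambda>j. map (\<lambda>r. r ! i) rs ! j) w)"
        using tup by (simp only: w(3) term_function_def restrict_apply if_True)
      also note cols
      also have "semigroup_prod m (map (\<lambda>j. semigroup_prod m (map (\<lambda>l. ?\<tau> ! l) (v j))) w) =
          semigroup_prod m (concat (map (\<lambda>j. map (\<lambda>l. ?\<tau> ! l) (v j)) w))"
      proof (rule semigroup_prod_concat[OF sg w(1), symmetric])
        fix j assume "j \<in> set w"
        then have "v j \<in> terms k" using w(2) v by auto
        then show "map (\<lambda>l. ?\<tau> ! l) (v j) \<noteq> [] \<and> set (map (\<lambda>l. ?\<tau> ! l) (v j)) \<subseteq> A"
          using \<tau> by (auto simp: terms_def tuples_def subset_iff)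
      qed
      also have "concat (map (\<lambda>j. map (\<lambda>l. ?\<tau> ! l) (v j)) w) = map (\<lambda>l. ?\<tau> ! l) ?u"
        by (simp add: map_concat comp_def)
      finally show ?thesis
        using \<tau> by (simp only: term_function_def restrict_apply if_True)
    qed
    then have "map (\<lambda>i. f (map (\<lambda>r. r ! i) rs)) [0..<length ts] =
        map (\<lambda>i. term_function A m k ?u (ts ! i)) [0..<length ts]" by simp
    also have "\<dots> = map (term_function A m k ?u) ts" by (intro nth_equalityI) auto
    finally show "map (\<lambda>i. f (map (\<lambda>r. r ! i) rs)) [0..<length ts] \<in> R"
      using u by (auto simp: R_def term_functions_def)
  qed
  have conv: "f \<in> term_functions A m n"
    if "1 \<le> n" "f \<in> operations n A" "preserves n f (length ts) R" for n f
    using that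
  proof (induction n arbitrary: f rule: less_induct)
    case (less n)
    show ?case
    proof (cases "n \<le> k")
      case True
      \<comment> \<open>The rows are the first \<open>n\<close> of the \<open>k\<close> projections.\<close>
      let ?rs = "map (\<lambda>j. map (\<lambda>\<tau>. \<tau> ! j) ts) [0..<n]"
      have "?rs \<in> tuples n R"
      proof -
        have "map (\<lambda>\<tau>. \<tau> ! j) ts \<in> R" if "j < n" for j
        proof -
          have "map (\<lambda>\<tau>. \<tau> ! j) ts = map (term_function A m k [j]) ts"
            by (simp add: ts term_function_def)
          moreover have "[j] \<in> terms k" using that True by (simp add: terms_def)
          ultimately show ?thesis by (auto simp: R_def term_functions_def)
        qed
        then show ?thesis by (auto simp: tuples_def)
      qed
      then have "map (\<lambda>i. f (map (\<lambda>r. r ! i) ?rs)) [0..<length ts] \<in> R"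
        using less.prems(3) by (simp only: preserves_def)
      then obtain t where t: "t \<in> term_functions A m k"
        and eq: "map (\<lambda>i. f (map (\<lambda>r. r ! i) ?rs)) [0..<length ts] = map t ts"
        by (auto simp: R_def)
      have ft: "f (map (\<lambda>j. \<tau> ! j) [0..<n]) = t \<tau>" if \<tau>: "\<tau> \<in> tuples k A" for \<tau>
      proof -
        have "\<tau> \<in> set ts" using \<tau> ts by simp
        then obtain i where i: "i < length ts" "\<tau> = ts ! i" by (auto simp: in_set_conv_nth)
        have "map (\<lambda>r. r ! i) ?rs = map (\<lambda>j. \<tau> ! j) [0..<n]" using i by simp
        then show ?thesis using arg_cong[OF eq, of "\<lambda>l. l ! i"] i by (simp del: map_map)
      qed
      \<comment> \<open>Surplus variables of the \<open>k\<close>-ary word are identified with the first variable.\<close>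
      let ?\<sigma> = "\<lambda>l. if l < n then l else 0"
      have \<sigma>: "?\<sigma> ` {..<k} \<subseteq> {..<n}" using less.prems(1) by auto
      have "f xs = reindex A k n ?\<sigma> t xs" for xs
      proof (cases "xs \<in> tuples n A")
        case xs: True
        let ?\<tau> = "map (\<lambda>l. xs ! ?\<sigma> l) [0..<k]"
        have "map (\<lambda>j. ?\<tau> ! j) [0..<n] = xs"
          using xs True by (intro nth_equalityI) (auto simp: tuples_def)
        then have "f xs = t ?\<tau>" using ft[OF map_nth_in_tuples[OF xs \<sigma>]] by (simp only:)
        then show ?thesis using xs by (simp only: reindex_def restrict_apply if_True)
      next
        case False
        with less.prems(2) show ?thesis
          by (auto simp: reindex_def operations_def PiE_def extensional_def)
      qed
      then have "f = reindex A k n ?\<sigma> t" by blast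
      then show ?thesis using reindex_term_functions[OF t \<sigma>] by simp
    next
      case False
      have "identify A n f i j \<in> term_functions A m n" if ij: "i < j" "j < n" for i j
      proof -
        \<comment> \<open>Drop the coordinate \<open>i\<close> and renumber; \<open>j - 1\<close> is the new number of \<open>j\<close> because \<open>i <
          j\<close>.\<close>
        let ?\<sigma> = "\<lambda>l. if l = i then j - 1 else if l < i then l else l - 1"
        let ?\<delta> = "\<lambda>l. if l < i then l else l + 1"
        let ?g = "reindex A n (n - 1) ?\<sigma> f"
        have \<sigma>: "?\<sigma> ` {..<n} \<subseteq> {..<n - 1}" using ij by auto
        have \<delta>: "?\<delta> ` {..<n - 1} \<subseteq> {..<n}" by auto
        have "?g \<in> term_functions A m (n - 1)"
          using less.IH[of "n - 1" ?g] ij reindex_operations[OF less.prems(2) \<sigma>]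
            reindex_preserves[OF less.prems(3) \<sigma> Rsub] by simp
        then have "reindex A (n - 1) n ?\<delta> ?g \<in> term_functions A m n"
          by (rule reindex_term_functions[OF _ \<delta>])
        moreover have "reindex A (n - 1) n ?\<delta> ?g = identify A n f i j"
        proof
          fix xs
          show "reindex A (n - 1) n ?\<delta> ?g xs = identify A n f i j xs"
          proof (cases "xs \<in> tuples n A")
            case True
            have "map (\<lambda>l. map (\<lambda>l. xs ! ?\<delta> l) [0..<n - 1] ! ?\<sigma> l) [0..<n] = xs[i := xs ! j]"
              using True ij by (intro nth_equalityI) (auto simp: tuples_def nth_list_update)
            then show ?thesis using True map_nth_in_tuples[OF True \<delta>]
              by (simp only: reindex_def identify_def restrict_apply if_True)
          qed (simp add: reindex_def identify_def)
        qed
        ultimately show ?thesis by simp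
      qed
      then show ?thesis using det less.prems(2) False
        by (auto simp: determined_by_minors_def)
    qed
  qed
  show ?thesis
    unfolding finitely_related_def
  proof (intro exI[of _ "{(length ts, R)}"] conjI allI impI)
    fix n :: nat assume "1 \<le> n"
    then show "term_functions A m n =
        {f \<in> operations n A. \<forall>(k, R)\<in>{(length ts, R)}. preserves n f k R}"
      using pres conv[of n] subsetD[OF term_functions_subset_operations[OF sg, of n]] by blast
  qed (use len Rsub in auto)
qed

section \<open>Sorting, monotone selection and interleaving of lists\<close>

lemma repeated_value:
  assumes "a ` Y \<subseteq> B" "finite B" "card B < card Y"
  obtains i j where "i \<in> Y" "j \<in> Y" "i \<noteq> j" "a i = a j"
proof -
  have "\<not> inj_on a Y"
    using assms card_inj_on_le[of a Y B] by linarith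
  then show ?thesis using that by (auto simp: inj_on_def)
qed

lemma two_elements:
  assumes "2 \<le> card Y"
  shows "\<exists>i\<in>Y. \<exists>j\<in>Y. i \<noteq> j"
proof -
  have "finite Y" using assms card.infinite by fastforce
  then show ?thesis using assms card_le_Suc0_iff_eq[of Y] by auto
qed

text \<open>A word is sorted as soon as every letter precedes all later ones; this form fits relations
  that are read off from splittings of a word.\<close>

lemma sorted_wrt_if_splits:
  assumes "\<And>u y v y'. w = u @ y # v \<Longrightarrow> y' \<in> set v \<Longrightarrow> P y y'"
  shows "sorted_wrt P w"
  using assms
proof (induction w)
  case (Cons a w)
  have "sorted_wrt P w"
    by (rule Cons.IH) (rule Cons.prems[of "a # _"], auto)
  moreover have "P a y'" if "y' \<in> set w" for y'
    using Cons.prems[of "[]" a w y'] that by simp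
  ultimately show ?case by simp
qed simp

lemma sorted_wrt_total:
  assumes "sorted_wrt P w" "x \<in> set w" "y \<in> set w" "x \<noteq> y"
  shows "P x y \<or> P y x"
  using assms by (induction w) auto

text \<open>Distinct elements may precede each other in both directions: over a commutative monoid any
  two linear variables do so in the sense used below.\<close>

lemma ex_sorted_wrt_enumeration:
  assumes "finite L"
    and "\<And>x y. x \<in> L \<Longrightarrow> y \<in> L \<Longrightarrow> x \<noteq> y \<Longrightarrow> P x y \<or> P y x"
    and "\<And>x y t. x \<in> L \<Longrightarrow> y \<in> L \<Longrightarrow> t \<in> L \<Longrightarrow> distinct [x, y, t] \<Longrightarrow> P x y \<Longrightarrow> P y t \<Longrightarrow> P x t"
  shows "\<exists>ys. distinct ys \<and> set ys = L \<and> sorted_wrt P ys"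
  using assms
proof (induction L rule: finite_induct)
  case (insert x L)
  have "\<exists>ys. distinct ys \<and> set ys = L \<and> sorted_wrt P ys"
  proof (rule insert.IH)
    show "P u v \<or> P v u" if "u \<in> L" "v \<in> L" "u \<noteq> v" for u v
      using insert.prems(1)[of u v] that by simp
    show "P u t" if "u \<in> L" "v \<in> L" "t \<in> L" "distinct [u, v, t]" "P u v" "P v t" for u v t
      by (rule insert.prems(2)[of u v t]) (use that in simp_all)
  qed
  then obtain ys where ys: "distinct ys" "set ys = L" "sorted_wrt P ys" by blast
  define us vs where "us = takeWhile (\<lambda>y. P y x) ys" and "vs = dropWhile (\<lambda>y. P y x) ys"
  have split: "ys = us @ vs" by (simp add: us_def vs_def)
  have us: "P y x" if "y \<in> set us" for y using that by (auto simp: us_def dest: set_takeWhileD)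
  have vs: "P x y" if y: "y \<in> set vs" for y
  proof (cases vs)
    case (Cons r vs')
    have r: "\<not> P r x" using Cons hd_dropWhile[of "\<lambda>y. P y x" ys] by (simp add: vs_def)
    have L: "set vs \<subseteq> L" "x \<notin> L" using ys split insert.hyps by auto
    then have "P x r" using r insert.prems(1)[of x r] Cons by auto
    moreover have "P r y" if "y \<noteq> r" using that y ys(3) split Cons by (simp add: sorted_wrt_append)
    ultimately show ?thesis
      using insert.prems(2)[of x r y] L y Cons by fastforce
  qed (use y in simp)
  have "distinct (us @ x # vs)" "set (us @ x # vs) = insert x L"
    using ys split insert.hyps by auto
  moreover have "sorted_wrt P (us @ x # vs)"
    using ys(3) us vs unfolding split by (auto simp: sorted_wrt_append)
  ultimately show ?case by blast
qed simp

lemma sorted_wrt_unique: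
  assumes "\<And>x y. x \<in> set xs \<Longrightarrow> y \<in> set xs \<Longrightarrow> x \<noteq> y \<Longrightarrow> P x y \<Longrightarrow> \<not> P y x"
    and "distinct xs" "distinct ys" "set xs = set ys" "sorted_wrt P xs" "sorted_wrt P ys"
  shows "xs = ys"
  using assms
proof (induction xs arbitrary: ys)
  case (Cons x xs)
  from Cons.prems(4) obtain y ys' where ys: "ys = y # ys'" by (cases ys) auto
  have "x = y"
  proof (rule ccontr)
    assume "x \<noteq> y"
    then have "y \<in> set xs" "x \<in> set ys'" using Cons.prems(4) ys by auto
    then have "P x y" "P y x" using Cons.prems(5,6) ys by auto
    then show False using Cons.prems(1)[of x y] \<open>x \<noteq> y\<close> \<open>y \<in> set xs\<close> by auto
  qed
  moreover have "xs = ys'"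
  proof (rule Cons.IH)
    show "set xs = set ys'" using Cons.prems(2,3,4) ys \<open>x = y\<close> by auto
  qed (use Cons.prems ys in auto)
  ultimately show ?case using ys by simp
qed simp

text \<open>A Helly property: a monotone choice of values \<open>p y \<in> C y\<close> along a list exists if it exists
  along all short sublists. The greedy choice always takes the least admissible value that is at
  least the current bound \<open>k\<close>. If it gets stuck, then the entries at which the bound was forced
  to rise, together with the entry where it fails, form an obstruction; the bound can rise at
  most \<open>m - k\<close> times, so at most \<open>m + 1 - k\<close> entries are involved. In the induction a sublist of
  the tail is extended by the head exactly when the head forces the bound to rise.\<close>

lemma monotone_selection:
  fixes C :: "'a \<Rightarrow> nat set"
  assumes "distinct s" "sorted_wrt P s" "k \<le> m" "\<And>y. y \<in> set s \<Longrightarrow> C y \<subseteq> {..m}"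
    and "\<And>t. distinct t \<Longrightarrow> sorted_wrt P t \<Longrightarrow> set t \<subseteq> set s \<Longrightarrow> length t \<le> m + 1 - k \<Longrightarrow>
      \<exists>p. sorted_wrt (\<lambda>y y'. p y \<le> p y') t \<and> (\<forall>y\<in>set t. k \<le> p y \<and> p y \<in> C y)"
  shows "\<exists>p. sorted_wrt (\<lambda>y y'. p y \<le> p y') s \<and> (\<forall>y\<in>set s. k \<le> p y \<and> p y \<in> C y)"
  using assms
proof (induction s arbitrary: k)
  case (Cons c s)
  let ?sel = "\<lambda>k t p. sorted_wrt (\<lambda>y y'. p y \<le> p y') t \<and> (\<forall>y\<in>set t. k \<le> p y \<and> p y \<in> C y)"
  have "\<exists>p. ?sel k [c] p" by (rule Cons.prems(5)) (use Cons.prems(3) in auto)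
  then have ex: "\<exists>q. k \<le> q \<and> q \<in> C c" by auto
  define v where "v = (LEAST q. k \<le> q \<and> q \<in> C c)"
  have v: "k \<le> v" "v \<in> C c" using LeastI_ex[OF ex] by (auto simp: v_def)
  have vmin: "v \<le> q" if "k \<le> q" "q \<in> C c" for q
    unfolding v_def by (rule Least_le) (use that in simp)
  have "v \<le> m" using v Cons.prems(4)[of c] by auto
  have "\<exists>p. ?sel v s p"
  proof (rule Cons.IH)
    fix t assume t: "distinct t" "sorted_wrt P t" "set t \<subseteq> set s" "length t \<le> m + 1 - v"
    show "\<exists>p. ?sel v t p"
    proof (cases "v = k")
      case True
      then show ?thesis using Cons.prems(5)[of t] t by auto
    next
      case False
      have "\<exists>p. ?sel k (c # t) p"
      proof (rule Cons.prems(5))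
        show "length (c # t) \<le> m + 1 - k" using False v(1) t(4) \<open>v \<le> m\<close> by simp
      qed (use t Cons.prems(1,2) in auto)
      then obtain p where p: "?sel k (c # t) p" by blast
      then have "v \<le> p c" using vmin by simp
      then have "?sel v t p" using p by fastforce
      then show ?thesis by blast
    qed
  qed (use Cons.prems \<open>v \<le> m\<close> in auto)
  then obtain p where p: "?sel v s p" by blast
  have "sorted_wrt (\<lambda>y y'. (p(c := v)) y \<le> (p(c := v)) y') s"
    using p Cons.prems(1) by (auto intro: sorted_wrt_mono_rel[of s "\<lambda>y y'. p y \<le> p y'"])
  then have "?sel k (c # s) (p(c := v))"
    using p v Cons.prems(1) by auto
  then show ?case by blast
qed simp

lemma ex_list_with_counts:
  assumes "finite X"
  shows "\<exists>u. set u \<subseteq> X \<and> (\<forall>x\<in>X. count_list u x = g x)"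
  using assms
proof (induction X rule: finite_induct)
  case (insert x X)
  then obtain u where u: "set u \<subseteq> X" "\<forall>x\<in>X. count_list u x = g x" by blast
  have [simp]: "count_list (replicate k x) y = (if x = y then k else 0)" for k y
    by (induction k) auto
  have "count_list u x = 0" using u(1) insert.hyps by (subst count_list_0_iff) auto
  then have "set (replicate (g x) x @ u) \<subseteq> insert x X \<and>
      (\<forall>y\<in>insert x X. count_list (replicate (g x) x @ u) y = g y)"
    using u insert.hyps by auto
  then show ?case by blast
qed simp

text \<open>Several families of insertions into one list are independent of each other: the copies of
  \<open>x\<close> are distributed over the gaps of \<open>ys\<close>, and the gap in front of an entry receives as many
  copies as \<open>p x\<close> increases there. The numbers \<open>c x\<close> of copies already used are needed for the
  induction.\<close>

lemma ex_interleaving: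
  fixes p :: "'a \<Rightarrow> 'a \<Rightarrow> nat"
  assumes "finite X" "distinct ys" "X \<inter> L = {}" "set ys \<subseteq> L"
    and "\<And>x. x \<in> X \<Longrightarrow> sorted_wrt (\<lambda>y y'. p x y \<le> p x y') ys"
    and "\<And>x y. x \<in> X \<Longrightarrow> y \<in> set ys \<Longrightarrow> c x \<le> p x y \<and> p x y \<le> tot x"
  shows "\<exists>w. set w \<subseteq> X \<union> set ys \<and> filter (\<lambda>i. i \<in> L) w = ys \<and>
    (\<forall>x\<in>X. count_list w x = tot x - c x \<and>
      (\<forall>y\<in>set ys. count_list (takeWhile (\<lambda>i. i \<noteq> y) w) x = p x y - c x))"
  using assms(2,4-)
proof (induction ys arbitrary: c)
  case Nil
  obtain u where "set u \<subseteq> X" "\<forall>x\<in>X. count_list u x = tot x - c x"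
    using ex_list_with_counts[OF assms(1), of "\<lambda>x. tot x - c x"] by blast
  moreover from this have "filter (\<lambda>i. i \<in> L) u = []"
    using assms(3) by (auto simp: filter_empty_conv)
  ultimately show ?case by auto
next
  case (Cons y0 ys)
  obtain u where u: "set u \<subseteq> X" "\<forall>x\<in>X. count_list u x = p x y0 - c x"
    using ex_list_with_counts[OF assms(1), of "\<lambda>x. p x y0 - c x"] by blast
  have "\<exists>w. set w \<subseteq> X \<union> set ys \<and> filter (\<lambda>i. i \<in> L) w = ys \<and>
    (\<forall>x\<in>X. count_list w x = tot x - p x y0 \<and>
      (\<forall>y\<in>set ys. count_list (takeWhile (\<lambda>i. i \<noteq> y) w) x = p x y - p x y0))"
    by (rule Cons.IH) (use Cons.prems in auto)
  then obtain w where w: "set w \<subseteq> X \<union> set ys" "filter (\<lambda>i. i \<in> L) w = ys"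
    "\<And>x. x \<in> X \<Longrightarrow> count_list w x = tot x - p x y0"
    "\<And>x y. x \<in> X \<Longrightarrow> y \<in> set ys \<Longrightarrow>
       count_list (takeWhile (\<lambda>i. i \<noteq> y) w) x = p x y - p x y0" by blast
  let ?w = "u @ y0 # w"
  have notL: "i \<notin> set u" if "i \<in> L" for i using u(1) assms(3) that by auto
  have y0: "y0 \<in> L" using Cons.prems by simp
  have "filter (\<lambda>i. i \<in> L) u = []" using u(1) assms(3) by (auto simp: filter_empty_conv)
  then have filt: "filter (\<lambda>i. i \<in> L) ?w = y0 # ys" using w(2) y0 by simp
  have "count_list ?w x = tot x - c x \<and> (\<forall>y\<in>set (y0 # ys).
      count_list (takeWhile (\<lambda>i. i \<noteq> y) ?w) x = p x y - c x)" if x: "x \<in> X" for x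
  proof (intro conjI ballI)
    have xy: "x \<noteq> y0" using x y0 assms(3) by auto
    have le: "c x \<le> p x y0" "p x y0 \<le> tot x" using Cons.prems(4)[OF x] by auto
    show "count_list ?w x = tot x - c x" using u(2) w(3)[OF x] x xy le by simp
    fix y assume y: "y \<in> set (y0 # ys)"
    then have "takeWhile (\<lambda>i. i \<noteq> y) u = u" using notL Cons.prems(2) by (auto simp: takeWhile_eq_all_conv)
    then have tw: "takeWhile (\<lambda>i. i \<noteq> y) ?w = u @ takeWhile (\<lambda>i. i \<noteq> y) (y0 # w)"
      using notL[of y] y Cons.prems(2) by (subst takeWhile_append2) auto
    show "count_list (takeWhile (\<lambda>i. i \<noteq> y) ?w) x = p x y - c x"
    proof (cases "y = y0")
      case True
      then show ?thesis using tw u(2) x by simp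
    next
      case False
      then have "y \<in> set ys" using y by simp
      moreover from this have "p x y0 \<le> p x y" using Cons.prems(3)[OF x] by simp
      ultimately show ?thesis using False tw u(2) x w(4)[OF x, of y] xy le by simp
    qed
  qed
  moreover have "set ?w \<subseteq> X \<union> set (y0 # ys)" using u(1) w(1) by auto
  ultimately show ?case using filt by blast
qed

lemma distinct_if_count_list_le_1:
  "(\<And>y. y \<in> set w \<Longrightarrow> count_list w y \<le> 1) \<Longrightarrow> distinct w"
proof (induction w)
  case (Cons a w)
  have "count_list w a = 0" using Cons.prems[of a] by simp
  moreover have "distinct w"
  proof (rule Cons.IH)
    show "count_list w y \<le> 1" if "y \<in> set w" for y
      using Cons.prems[of y] that by (simp split: if_splits)
  qed
  ultimately show ?case by (simp add: count_list_0_iff)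
qed simp

lemma one_le_count_list: "x \<in> set w \<Longrightarrow> 1 \<le> count_list w x"
  by (induction w) auto

lemma count_list_eq_1_if_distinct: "distinct w \<Longrightarrow> x \<in> set w \<Longrightarrow> count_list w x = 1"
  by (induction w) (auto simp: count_list_0_iff)

lemma count_list_filter: "P x \<Longrightarrow> count_list (filter P w) x = count_list w x"
  by (induction w) auto

lemma card_le_sum_count_list:
  assumes "Y \<subseteq> set w"
  shows "card Y \<le> (\<Sum>i\<in>Y. count_list w i)"
proof -
  have "(\<Sum>i\<in>Y. 1) \<le> (\<Sum>i\<in>Y. count_list w i)"
    by (rule sum_mono) (use assms one_le_count_list in fastforce)
  then show ?thesis by simp
qed

lemma sum_count_list_eq_length_filter:
  assumes "finite Y"
  shows "(\<Sum>i\<in>Y. count_list w i) = length (filter (\<lambda>i. i \<in> Y) w)"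
proof (induction w)
  case (Cons a w)
  have "(\<Sum>i\<in>Y. count_list (a # w) i) = (\<Sum>i\<in>Y. count_list w i + (if a = i then 1 else 0))"
    by (rule sum.cong) auto
  then show ?case using Cons assms by (simp add: sum.distrib sum.delta')
qed simp

section \<open>Evaluation of words in a 4-nilpotent monoid\<close>

text \<open>The common value \<open>z\<close> of all products of four elements of \<open>N\<close> is a zero of the monoid
  (lemma \<open>z_absorb\<close>), so \<open>z\<close> is the value of every word in which four letters are not \<open>\<one>\<close>.\<close>

locale nilpotent4 = monoid S for S :: "('a, 'b) monoid_scheme" (structure) +
  fixes N :: "'a set" and z :: 'a
  assumes carrier_eq: "carrier S = insert \<one> N" and one_notin: "\<one> \<notin> N"
    and N_closed: "\<And>a b. a \<in> N \<Longrightarrow> b \<in> N \<Longrightarrow> a \<otimes> b \<in> N"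
    and z_in: "z \<in> N" and finite_N: "finite N"
    and nil: "\<And>a b c d. a \<in> N \<Longrightarrow> b \<in> N \<Longrightarrow> c \<in> N \<Longrightarrow> d \<in> N \<Longrightarrow> a \<otimes> (b \<otimes> (c \<otimes> d)) = z"
begin

text \<open>Valuations are total functions on variable indices; the neutral element lets words be
  shortened and also gives the empty word a value.\<close>

definition ev :: "(nat \<Rightarrow> 'a) \<Rightarrow> nat list \<Rightarrow> 'a" where
  "ev a w = foldr (\<lambda>i r. a i \<otimes> r) w \<one>"

lemma ev_simps [simp]: "ev a [] = \<one>" "ev a (i # w) = a i \<otimes> ev a w"
  by (simp_all add: ev_def)

lemma N_carrier: "a \<in> N \<Longrightarrow> a \<in> carrier S"
  by (simp add: carrier_eq)

lemma ev_closed: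
  assumes "\<And>i. i \<in> set w \<Longrightarrow> a i \<in> carrier S"
  shows "ev a w \<in> carrier S"
  using assms by (induction w) auto

lemma ev_append:
  assumes "\<And>i. i \<in> set (v @ w) \<Longrightarrow> a i \<in> carrier S"
  shows "ev a (v @ w) = ev a v \<otimes> ev a w"
  using assms
proof (induction v)
  case (Cons i v)
  have "ev a v \<in> carrier S" "ev a w \<in> carrier S" "a i \<in> carrier S"
    using Cons.prems by (auto intro: ev_closed)
  then show ?case using Cons by (simp add: m_assoc)
qed (simp add: ev_closed)

lemma ev_cong: "(\<And>i. i \<in> set w \<Longrightarrow> a i = b i) \<Longrightarrow> ev a w = ev b w"
  by (induction w) auto

lemma ev_map: "ev a (map \<sigma> w) = ev (\<lambda>i. a (\<sigma> i)) w"
  by (induction w) auto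

text \<open>Setting a variable to \<open>\<one>\<close> deletes it from the word. All information that is extracted
  below from a function about words comes from such deletions.\<close>

lemma ev_filter:
  assumes "\<And>i. i \<in> set w \<Longrightarrow> a i \<in> carrier S" "\<And>i. i \<in> set w \<Longrightarrow> \<not> P i \<Longrightarrow> a i = \<one>"
  shows "ev a (filter P w) = ev a w"
  using assms
proof (induction w)
  case (Cons i w)
  have "ev a w \<in> carrier S" using Cons.prems(1) by (intro ev_closed) auto
  then show ?case using Cons by auto
qed simp

lemma ev_in_N:
  assumes "w \<noteq> []" "\<And>i. i \<in> set w \<Longrightarrow> a i \<in> N"
  shows "ev a w \<in> N"
  using assms
proof (induction w)
  case (Cons i w)
  then show ?case by (cases "w = []") (auto simp: N_carrier intro: N_closed)
qed simp

lemma ev_all_nonunit: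
  assumes "4 \<le> length w" "\<And>i. i \<in> set w \<Longrightarrow> a i \<in> N"
  shows "ev a w = z"
proof -
  obtain i j k v where w: "w = i # j # k # v" "v \<noteq> []"
    using assms(1)
    by (cases w; cases "tl w"; cases "tl (tl w)"; cases "tl (tl (tl w))") auto
  then show ?thesis using assms(2) ev_in_N[of v a] nil by simp
qed

lemma ev_eq_zero:
  assumes "\<And>i. i \<in> set w \<Longrightarrow> a i \<in> carrier S" "4 \<le> length (filter (\<lambda>i. a i \<noteq> \<one>) w)"
  shows "ev a w = z"
proof -
  have "ev a w = ev a (filter (\<lambda>i. a i \<noteq> \<one>) w)" using assms(1) by (intro ev_filter[symmetric]) auto
  also have "\<dots> = z"
    using assms by (intro ev_all_nonunit) (auto simp: carrier_eq)
  finally show ?thesis .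
qed

text \<open>Multiplying a product of four elements by a further element of \<open>N\<close> gives again a product
  of four factors.\<close>

lemma z_absorb: "b \<in> carrier S \<Longrightarrow> z \<otimes> b = z" "b \<in> carrier S \<Longrightarrow> b \<otimes> z = z"
proof -
  have zz: "z = z \<otimes> (z \<otimes> (z \<otimes> z))" using nil[OF z_in z_in z_in z_in] by simp
  have zc: "z \<in> carrier S" "z \<otimes> z \<in> N" using z_in by (auto simp: N_carrier N_closed)
  have "b \<otimes> z = z \<and> z \<otimes> b = z" if "b \<in> N"
  proof -
    have b: "b \<in> carrier S" using that by (rule N_carrier)
    have "b \<otimes> (z \<otimes> (z \<otimes> (z \<otimes> z))) = z" by (intro nil) (use that z_in zc in auto)
    moreover have "z \<otimes> (z \<otimes> (z \<otimes> (z \<otimes> b))) = z"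
      by (intro nil) (use that z_in zc in \<open>auto intro: N_closed\<close>)
    then have "(z \<otimes> (z \<otimes> (z \<otimes> z))) \<otimes> b = z" using b zc by (simp add: m_assoc)
    ultimately show ?thesis using zz by simp
  qed
  then show "b \<in> carrier S \<Longrightarrow> z \<otimes> b = z" "b \<in> carrier S \<Longrightarrow> b \<otimes> z = z"
    using zc by (auto simp: carrier_eq)
qed

lemma ev_with_zero:
  assumes "\<And>i. i \<in> set w \<Longrightarrow> a i \<in> carrier S" "j \<in> set w" "a j = z"
  shows "ev a w = z"
  using assms
proof (induction w)
  case (Cons i w)
  have "ev a w \<in> carrier S" using Cons.prems(1) by (intro ev_closed) auto
  then show ?case using Cons by (cases "i = j") (auto simp: z_absorb)
qed simp

lemma ev_power:
  assumes "a x \<in> carrier S" "\<And>i. i \<in> set w \<Longrightarrow> i \<noteq> x \<Longrightarrow> a i = \<one>"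
  shows "ev a w = a x [^] count_list w x"
  using assms
proof (induction w)
  case (Cons i w)
  then show ?case by (cases "i = x") (simp_all flip: nat_pow_Suc2)
qed simp

lemma power_long:
  assumes "b \<in> N" "4 \<le> (k::nat)"
  shows "b [^] k = z"
proof -
  have "count_list (replicate k (0::nat)) 0 = k" by (induction k) auto
  then show ?thesis
    using assms ev_all_nonunit[of "replicate k 0" "\<lambda>_. b"]
      ev_power[of "\<lambda>_. b" 0 "replicate k 0"]
    by (simp add: N_carrier)
qed

lemma power_in_N:
  assumes "b \<in> N" "1 \<le> (k::nat)"
  shows "b [^] k \<in> N"
  using assms(2)
proof (induction k rule: dec_induct)
  case (step k)
  then show ?case using assms(1) by (simp add: N_closed)
qed (use assms in \<open>simp add: N_carrier\<close>)

text \<open>Iterating \<open>b = b\<^sup>k\<close> produces arbitrarily long products.\<close>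

lemma eq_power_imp_zero:
  assumes "b \<in> N" "2 \<le> k" "b = b [^] (k::nat)"
  shows "b = z"
proof -
  have "b = (b [^] k) [^] k" using assms(3) by simp
  also have "\<dots> = b [^] (k * k)" using assms(1) by (simp add: nat_pow_pow N_carrier)
  also have "\<dots> = z" using assms mult_le_mono[of 2 k 2 k] by (intro power_long) auto
  finally show ?thesis .
qed

text \<open>If \<open>b\<^sup>2\<close> equals a higher power, then exponents can be raised until the product has four
  factors.\<close>

lemma square_eq_power_imp_zero:
  assumes "b \<in> N" "3 \<le> k" "b \<otimes> b = b [^] (k::nat)"
  shows "b \<otimes> b = z"
proof -
  have b: "b \<in> carrier S" using assms(1) by (rule N_carrier)
  have sq: "b \<otimes> b = b [^] (2::nat)" using b by (simp add: numeral_2_eq_2)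
  show ?thesis
  proof (cases "4 \<le> k")
    case True
    then show ?thesis using assms power_long by simp
  next
    case False
    then have k: "k = 3" using assms(2) by simp
    have "b \<otimes> b = b [^] (2::nat) \<otimes> b" using assms(3) k b by (simp add: numeral_3_eq_3 numeral_2_eq_2)
    also have "\<dots> = b [^] (3::nat) \<otimes> b" using assms(3) k sq by simp
    also have "\<dots> = b [^] (4::nat)" using nat_pow_Suc[of b 3] by simp
    finally show ?thesis using power_long[OF assms(1), of "4::nat"] by simp
  qed
qed

abbreviation one_at :: "nat \<Rightarrow> 'a \<Rightarrow> nat \<Rightarrow> 'a" where
  "one_at x b \<equiv> (\<lambda>_. \<one>)(x := b)"

abbreviation two_at :: "nat \<Rightarrow> 'a \<Rightarrow> nat \<Rightarrow> 'a \<Rightarrow> nat \<Rightarrow> 'a" where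
  "two_at x a y b \<equiv> (\<lambda>_. \<one>)(x := a, y := b)"

lemma ev_all_ones: "(\<And>i. i \<in> set w \<Longrightarrow> a i = \<one>) \<Longrightarrow> ev a w = \<one>"
  by (induction w) auto

lemma ev_one_at:
  "b \<in> carrier S \<Longrightarrow> ev (one_at x b) w = b [^] count_list w x"
  using ev_power[of "one_at x b" x w] by simp

text \<open>The value at a point with only two nontrivial coordinates shows how many copies of \<open>x\<close>
  stand on either side of the single occurrence of \<open>y\<close>.\<close>

lemma ev_two_at:
  assumes "a \<in> carrier S" "b \<in> carrier S" "x \<noteq> y" "y \<notin> set u" "y \<notin> set v"
  shows "ev (two_at x a y b) (u @ y # v) = a [^] count_list u x \<otimes> (b \<otimes> a [^] count_list v x)"
proof -
  have "ev (two_at x a y b) t = a [^] count_list t x" if "y \<notin> set t" for t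
  proof -
    have "ev (two_at x a y b) t = two_at x a y b x [^] count_list t x"
      by (rule ev_power) (use assms that in auto)
    then show ?thesis using assms(3) by simp
  qed
  then show ?thesis using assms by (subst ev_append) auto
qed

lemma ev_two_at_equal:
  assumes "b \<in> carrier S" "x \<noteq> y"
  shows "ev (two_at x b y b) w = b [^] (count_list w x + count_list w y)"
proof (induction w)
  case (Cons i w)
  then show ?case using assms
    by (cases "i = x"; cases "i = y") (simp_all flip: nat_pow_Suc2)
qed simp

end

section \<open>Functions whose minors are given by words\<close>

text \<open>\<open>F\<close> stands for an \<open>n\<close>-ary operation applied to the first \<open>n\<close> values of a valuation. That a
  minor is a term function is expressed on the valuations with \<open>a i = a j\<close>, on which the minor
  agrees with the operation; this makes the condition symmetric in \<open>i\<close> and \<open>j\<close>. The bound on \<open>n\<close>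
  says that \<open>n\<close> exceeds the order of the monoid by at least two.\<close>

locale nilpotent4_minors = nilpotent4 S N z
  for S :: "('a, 'b) monoid_scheme" (structure) and N z +
  fixes n :: nat and F :: "(nat \<Rightarrow> 'a) \<Rightarrow> 'a"
  assumes n_ge: "card N + 3 \<le> n"
    and F_cong: "\<And>a b. (\<And>i. i < n \<Longrightarrow> a i = b i) \<Longrightarrow> F a = F b"
    and minors: "\<And>i j. i < n \<Longrightarrow> j < n \<Longrightarrow> i \<noteq> j \<Longrightarrow>
      \<exists>w. w \<noteq> [] \<and> set w \<subseteq> {..<n} \<and>
        (\<forall>a. range a \<subseteq> carrier S \<longrightarrow> a i = a j \<longrightarrow> F a = ev a w)"
begin

lemma n_ge4: "4 \<le> n"
proof -
  have "card N \<noteq> 0" using finite_N z_in by (auto simp: card_eq_0_iff)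
  then show ?thesis using n_ge by simp
qed

lemma card_carrier: "card (carrier S) = card N + 1" "finite (carrier S)"
  using carrier_eq one_notin finite_N by auto

text \<open>A local description of \<open>F\<close>: it only concerns points with value \<open>\<one>\<close> outside \<open>Y\<close>, because
  such points are in reach of the minors when \<open>Y\<close> is small.\<close>

definition represents :: "nat list \<Rightarrow> nat set \<Rightarrow> bool" where
  "represents w Y \<longleftrightarrow> set w \<subseteq> Y \<and>
     (\<forall>a. range a \<subseteq> carrier S \<longrightarrow> (\<forall>i<n. i \<notin> Y \<longrightarrow> a i = \<one>) \<longrightarrow> F a = ev a w)"

lemma representsD:
  assumes "represents w Y" "range a \<subseteq> carrier S" "\<And>i. i < n \<Longrightarrow> i \<notin> Y \<Longrightarrow> a i = \<one>"
  shows "F a = ev a w"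
  using assms unfolding represents_def by blast

text \<open>Two coordinates outside \<open>Y\<close> both carry the value \<open>\<one>\<close>, so the point lies in the scope of a
  minor.\<close>

lemma ex_represents:
  assumes "Y \<subseteq> {..<n}" "card Y + 2 \<le> n"
  shows "\<exists>w. represents w Y"
proof -
  have "2 \<le> card ({..<n} - Y)" using assms by (simp add: card_Diff_subset finite_subset)
  then obtain i j where ij: "i \<in> {..<n} - Y" "j \<in> {..<n} - Y" "i \<noteq> j"
    using two_elements by blast
  then obtain w where w: "set w \<subseteq> {..<n}"
    "\<And>a. range a \<subseteq> carrier S \<Longrightarrow> a i = a j \<Longrightarrow> F a = ev a w"
    using minors[of i j] by auto
  have "F a = ev a (filter (\<lambda>i. i \<in> Y) w)"
    if a: "range a \<subseteq> carrier S" "\<forall>i<n. i \<notin> Y \<longrightarrow> a i = \<one>" for a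
  proof -
    have "F a = ev a w" by (rule w(2)) (use a ij in auto)
    also have "\<dots> = ev a (filter (\<lambda>i. i \<in> Y) w)"
      by (rule ev_filter[symmetric]) (use a w(1) in auto)
    finally show ?thesis .
  qed
  then have "represents (filter (\<lambda>i. i \<in> Y) w) Y" by (auto simp: represents_def)
  then show ?thesis by blast
qed

lemma z_neq_one: "z \<noteq> \<one>" using z_in one_notin by auto

text \<open>The zero detects the content of a word.\<close>

lemma ev_zero_at: "ev (one_at l z) w = (if l \<in> set w then z else \<one>)"
proof (cases "l \<in> set w")
  case True
  then show ?thesis
    using ev_with_zero[of w "one_at l z" l] z_in by (auto simp: N_carrier)
next
  case False
  then have "count_list w l = 0" by (simp add: count_list_0_iff)
  then show ?thesis using False ev_one_at[of z l w] z_in by (simp add: N_carrier)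
qed

text \<open>If the value at the point with \<open>z\<close> in coordinate \<open>l\<close> is \<open>\<one>\<close>, then \<open>l\<close> cannot occur in the
  word of any minor that does not involve \<open>l\<close>. Since two of the other coordinates always
  coincide, \<open>F\<close> does not depend on coordinate \<open>l\<close> at all, and therefore \<open>F\<close> is, up to renaming a
  variable, one of its own minors.\<close>

lemma ex_word_if_inessential:
  assumes l: "l < n" and F1: "F (one_at l z) = \<one>"
  shows "\<exists>w. w \<noteq> [] \<and> set w \<subseteq> {..<n} \<and> (\<forall>a. range a \<subseteq> carrier S \<longrightarrow> F a = ev a w)"
proof -
  have indep: "F (a(l := c)) = F a" if a: "range a \<subseteq> carrier S" "c \<in> carrier S" for a c
  proof -
    have "card (carrier S) < card ({..<n} - {l})" using l n_ge card_carrier by simp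
    then obtain i j where ij: "i \<in> {..<n} - {l}" "j \<in> {..<n} - {l}" "i \<noteq> j" "a i = a j"
      using repeated_value[of a "{..<n} - {l}" "carrier S"] a card_carrier by blast
    then obtain w where w: "\<And>a. range a \<subseteq> carrier S \<Longrightarrow> a i = a j \<Longrightarrow> F a = ev a w"
      using minors[of i j] by auto
    have "F (one_at l z) = ev (one_at l z) w"
      by (rule w) (use ij z_in in \<open>auto simp: N_carrier\<close>)
    then have lw: "l \<notin> set w" using F1 ev_zero_at z_neq_one by (auto split: if_splits)
    have "F (a(l := c)) = ev (a(l := c)) w" by (rule w) (use ij a in auto)
    also have "\<dots> = ev a w" by (rule ev_cong) (use lw in auto)
    also have "\<dots> = F a" by (rule w[symmetric]) (use ij a in auto)
    finally show ?thesis .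
  qed
  obtain i where i: "i < n" "i \<noteq> l"
    using n_ge4 that[of "if l = 0 then 1 else 0"] by auto
  then obtain w where w: "w \<noteq> []" "set w \<subseteq> {..<n}"
    "\<And>a. range a \<subseteq> carrier S \<Longrightarrow> a i = a l \<Longrightarrow> F a = ev a w"
    using minors[of i l] l by auto
  let ?\<sigma> = "\<lambda>k. if k = l then i else k"
  have "F a = ev a (map ?\<sigma> w)" if a: "range a \<subseteq> carrier S" for a
  proof -
    have "F a = F (a(l := a i))"
      by (rule indep[symmetric]) (use a in auto)
    also have "\<dots> = ev (a(l := a i)) w" by (rule w(3)) (use a i in auto)
    also have "\<dots> = ev a (map ?\<sigma> w)" unfolding ev_map by (rule ev_cong) auto
    finally show ?thesis .
  qed
  moreover have "map ?\<sigma> w \<noteq> []" "set (map ?\<sigma> w) \<subseteq> {..<n}" using w i by auto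
  ultimately show ?thesis by blast
qed

lemma essential_occurs:
  assumes "F (one_at l z) \<noteq> \<one>" "l < n" "i < n" "j < n" "l \<noteq> i" "l \<noteq> j"
    and "\<And>a. range a \<subseteq> carrier S \<Longrightarrow> a i = a j \<Longrightarrow> F a = ev a w"
  shows "l \<in> set w"
proof -
  have "F (one_at l z) = ev (one_at l z) w"
    by (rule assms(7)) (use assms z_in in \<open>auto simp: N_carrier\<close>)
  then show ?thesis using assms(1) ev_zero_at by (auto split: if_splits)
qed

text \<open>A word without the variable \<open>l\<close> has the value \<open>\<one>\<close> at the point with \<open>z\<close> in coordinate \<open>l\<close>
  and \<open>\<one>\<close> elsewhere.\<close>

lemma represents_set:
  assumes "\<And>l. l < n \<Longrightarrow> F (one_at l z) \<noteq> \<one>" "represents w Y" "Y \<subseteq> {..<n}"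
  shows "set w = Y"
proof -
  have "l \<in> set w" if "l \<in> Y" for l
  proof -
    have "F (one_at l z) = ev (one_at l z) w"
      by (rule representsD[OF assms(2)]) (use that z_in in \<open>auto simp: N_carrier\<close>)
    then show ?thesis using assms(1)[of l] assms(3) that ev_zero_at by (auto split: if_splits)
  qed
  then show ?thesis using assms(2) by (auto simp: represents_def)
qed

lemma F_all_ones:
  assumes "\<And>i. i < n \<Longrightarrow> a i = \<one>"
  shows "F a = \<one>"
proof -
  obtain w where "represents w {}" using ex_represents[of "{}"] n_ge4 by auto
  then have "F (\<lambda>_. \<one>) = \<one>" by (auto simp: represents_def)
  then show ?thesis using F_cong[of a "\<lambda>_. \<one>"] assms by simp
qed

text \<open>At a point other than the all-ones point, some local word or minor applies that contains,
  by essentiality, a variable with value \<open>z\<close>.\<close>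

lemma word_if_N_trivial:
  assumes ess: "\<And>l. l < n \<Longrightarrow> F (one_at l z) \<noteq> \<one>" and N: "N = {z}" and a: "range a \<subseteq> carrier S"
  shows "F a = ev a [0..<n]"
proof (cases "\<forall>i<n. a i = \<one>")
  case True
  then show ?thesis
    using F_all_ones[of a] ev_all_ones[of "[0..<n]" a] by simp
next
  case False
  have az: "a i = z" if "a i \<noteq> \<one>" for i using a that N carrier_eq by auto
  have ac: "a i \<in> carrier S" for i using a by auto
  define Y where "Y = {i. i < n \<and> a i \<noteq> \<one>}"
  have Y: "Y \<subseteq> {..<n}" "finite Y" "Y \<noteq> {}" using False by (auto simp: Y_def)
  have "ev a [0..<n] = z"
  proof -
    obtain i where "i < n" "a i \<noteq> \<one>" using False by blast
    then show ?thesis using ev_with_zero[of "[0..<n]" a i] ac az by auto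
  qed
  moreover have "F a = z"
  proof (cases "card Y + 2 \<le> n")
    case True
    obtain w where w: "represents w Y" using ex_represents[OF Y(1) True] by blast
    then have "F a = ev a w" using a unfolding represents_def Y_def by auto
    moreover obtain i where "i \<in> Y" using Y by blast
    ultimately show ?thesis
      using ev_with_zero[of w a i] ac az represents_set[OF ess w Y(1)] by (auto simp: Y_def)
  next
    case False
    then have c: "3 \<le> card Y" using n_ge4 by simp
    then obtain i j where ij: "i \<in> Y" "j \<in> Y" "i \<noteq> j"
      using two_elements[of Y] by auto
    have "card (Y - {i, j}) \<noteq> 0" using c ij Y(2) by (simp add: card_Diff_subset)
    then obtain l where l: "l \<in> Y" "l \<noteq> i" "l \<noteq> j" by (auto simp: card_eq_0_iff)
    obtain w where w: "\<And>a. range a \<subseteq> carrier S \<Longrightarrow> a i = a j \<Longrightarrow> F a = ev a w"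
      using minors[of i j] ij by (auto simp: Y_def)
    have "l \<in> set w"
      using essential_occurs[OF ess, of l i j w] l ij w by (auto simp: Y_def)
    moreover have "F a = ev a w" using w[of a] a az ij by (auto simp: Y_def)
    ultimately show ?thesis using ev_with_zero[of w a l] ac az l by (auto simp: Y_def)
  qed
  ultimately show ?thesis by simp
qed

end

section \<open>Gluing local words when every variable is essential\<close>

text \<open>The main case: all variables are essential, and \<open>N\<close> has an element besides the zero, so
  that the exponent one can be told apart from higher exponents.\<close>

locale nilpotent4_essential = nilpotent4_minors S N z n F
  for S :: "('a, 'b) monoid_scheme" (structure) and N z n F +
  assumes essential: "\<And>l. l < n \<Longrightarrow> F (one_at l z) \<noteq> \<one>"
    and nontrivial: "N \<noteq> {z}"
begin

lemma card_N: "2 \<le> card N" and n_ge5: "5 \<le> n"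
proof -
  obtain b where b: "b \<in> N" "b \<noteq> z" using nontrivial z_in by blast
  have "card {b, z} \<le> card N" by (rule card_mono) (use b z_in finite_N in auto)
  then show "2 \<le> card N" using b by simp
  then show "5 \<le> n" using n_ge by simp
qed

text \<open>The variables that occur exactly once in the words describing \<open>F\<close>.\<close>

definition linear_vars :: "nat set" where
  "linear_vars = {l. l < n \<and> (\<forall>b\<in>N. F (one_at l b) = b)}"

text \<open>The variables that may be given exponent two. If all squares of \<open>N\<close> vanish, then the unary
  functions do not show whether the exponent is two or larger, but the places of two copies can
  still matter, because \<open>a b a\<close> may be different from \<open>z\<close> although \<open>a\<^sup>2 = z\<close>.\<close>

definition square_vars :: "nat set" where
  "square_vars = {l. l < n \<and> (\<forall>b\<in>N. F (one_at l b) = b \<otimes> b)}"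

definition precedes :: "nat \<Rightarrow> nat \<Rightarrow> bool" where
  "precedes y y' \<longleftrightarrow> (\<forall>a\<in>N. \<forall>b\<in>N. F (two_at y a y' b) = a \<otimes> b)"

text \<open>The numbers \<open>q\<close> for which \<open>x\<^sup>q y x\<^sup>2\<^sup>-\<^sup>q\<close> describes \<open>F\<close> on the variables \<open>x\<close> and \<open>y\<close>. There
  can be several of them, depending on which of the words \<open>yxx\<close>, \<open>xyx\<close>, \<open>xxy\<close> agree on the
  monoid.\<close>

definition insertion_counts :: "nat \<Rightarrow> nat \<Rightarrow> nat set" where
  "insertion_counts x y = {q. q \<le> 2 \<and>
     (\<forall>a\<in>N. \<forall>b\<in>N. F (two_at x a y b) = a [^] q \<otimes> (b \<otimes> a [^] (2 - q)))}"

lemma represents_one_at: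
  assumes "represents w Y" "l \<in> Y" "b \<in> N"
  shows "F (one_at l b) = b [^] count_list w l"
proof -
  have "F (one_at l b) = ev (one_at l b) w"
    by (rule representsD[OF assms(1)]) (use assms in \<open>auto simp: N_carrier\<close>)
  then show ?thesis using ev_one_at assms(3) by (simp add: N_carrier)
qed

lemma represents_two_at:
  assumes "represents w Y" "x \<in> Y" "y \<in> Y" "a \<in> N" "b \<in> N"
  shows "F (two_at x a y b) = ev (two_at x a y b) w"
  by (rule representsD[OF assms(1)]) (use assms in \<open>auto simp: N_carrier\<close>)

lemma non_idempotent:
  assumes "2 \<le> (k::nat)"
  obtains b where "b \<in> N" "b [^] k \<noteq> b"
proof -
  obtain b where "b \<in> N" "b \<noteq> z" using nontrivial z_in by blast
  then show ?thesis using that eq_power_imp_zero[of b k] assms by metis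
qed

text \<open>The unary functions of \<open>F\<close> determine the exponents as far as they matter: exponent one is
  recognised because \<open>b = b\<^sup>k\<close> forces \<open>b = z\<close>, and an ambiguity between exponent two and higher
  exponents forces all squares of \<open>N\<close> to vanish.\<close>

lemma represents_count:
  assumes w: "represents w Y" "Y \<subseteq> {..<n}" and l: "l \<in> Y"
  shows "1 \<le> count_list w l"
    and "l \<in> linear_vars \<longleftrightarrow> count_list w l = 1"
    and "l \<notin> linear_vars \<Longrightarrow> l \<notin> square_vars \<Longrightarrow> 3 \<le> count_list w l"
    and "l \<in> square_vars \<Longrightarrow> 3 \<le> count_list w l \<Longrightarrow> b \<in> N \<Longrightarrow> b \<otimes> b = z"
proof -
  have "l \<in> set w" using represents_set[OF essential w] l by simp
  then show ge1: "1 \<le> count_list w l" by (rule one_le_count_list)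
  have Fl: "F (one_at l b) = b [^] count_list w l" if "b \<in> N" for b
    by (rule represents_one_at[OF w(1) l that])
  have ln: "l < n" using w(2) l by auto
  show lin: "l \<in> linear_vars \<longleftrightarrow> count_list w l = 1"
  proof
    assume lin: "l \<in> linear_vars"
    show "count_list w l = 1"
    proof (rule ccontr)
      assume "count_list w l \<noteq> 1"
      then have "2 \<le> count_list w l" using ge1 by simp
      then obtain b where "b \<in> N" "b [^] count_list w l \<noteq> b" by (rule non_idempotent)
      then show False using lin Fl by (auto simp: linear_vars_def)
    qed
  next
    assume "count_list w l = 1"
    then show "l \<in> linear_vars" using Fl ln by (auto simp: linear_vars_def N_carrier)
  qed
  show "3 \<le> count_list w l" if "l \<notin> linear_vars" "l \<notin> square_vars"
  proof -
    have "count_list w l \<noteq> 2"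
      using Fl ln that(2) by (auto simp: square_vars_def numeral_2_eq_2 N_carrier)
    then show ?thesis using lin ge1 that(1) by simp
  qed
  show "b \<otimes> b = z" if "l \<in> square_vars" "3 \<le> count_list w l" "b \<in> N"
    using square_eq_power_imp_zero[of b "count_list w l"] that Fl[of b]
    by (simp add: square_vars_def)
qed

lemma square_not_linear: "x \<in> square_vars \<Longrightarrow> x \<notin> linear_vars"
proof
  assume "x \<in> square_vars" "x \<in> linear_vars"
  then have "b [^] (2::nat) = b" if "b \<in> N" for b
    using that by (simp add: square_vars_def linear_vars_def numeral_2_eq_2 N_carrier)
  then show False using non_idempotent[of 2] by auto
qed

lemma split_at_linear:
  assumes "represents w Y" "Y \<subseteq> {..<n}" "y \<in> Y" "y \<in> linear_vars"
  obtains u v where "w = u @ y # v" "y \<notin> set u" "y \<notin> set v"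
proof -
  have c: "count_list w y = 1" using represents_count(2)[OF assms(1-3)] assms(4) by simp
  then have "y \<in> set w" using count_list_0_iff[of w y] by auto
  then obtain u v where w: "w = u @ y # v" "y \<notin> set u" by (blast dest: split_list_first)
  then have "count_list v y = 0" using c by simp
  then show ?thesis using that w by (simp add: count_list_0_iff)
qed

lemma precedes_if_split:
  assumes "represents w Y" "Y \<subseteq> {..<n}" "w = u @ y # v" "y' \<in> set v"
    "y \<in> linear_vars" "y' \<in> linear_vars"
  shows "precedes y y'"
proof -
  have wY: "set w = Y" using represents_set[OF essential assms(1,2)] .
  then have Y: "y \<in> Y" "y' \<in> Y" using assms(3,4) by auto
  have cy: "count_list w y = 1" and cy': "count_list w y' = 1"
    using represents_count(2)[OF assms(1,2)] Y assms(5,6) by auto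
  have "1 \<le> count_list v y'" using assms(4) by (rule one_le_count_list)
  then have c: "count_list u y' = 0" "count_list v y' = 1" "y \<noteq> y'"
    using cy' assms(3) by (auto split: if_splits)
  have yuv: "y \<notin> set u" "y \<notin> set v"
    using cy assms(3) by (auto simp: count_list_0_iff)
  have "F (two_at y a y' b) = a \<otimes> b" if "a \<in> N" "b \<in> N" for a b
  proof -
    have "two_at y a y' b = two_at y' b y a" using c(3) by (simp add: fun_upd_twist)
    then have "F (two_at y a y' b) = ev (two_at y' b y a) w"
      using represents_two_at[OF assms(1) Y that] by simp
    also have "\<dots> = b [^] count_list u y' \<otimes> (a \<otimes> b [^] count_list v y')"
      unfolding assms(3) using that c yuv by (intro ev_two_at) (auto simp: N_carrier)
    finally show ?thesis using c that by (simp add: N_carrier)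
  qed
  then show ?thesis by (simp add: precedes_def)
qed

lemma represents_linear:
  assumes "represents w Y" "Y \<subseteq> linear_vars"
  shows "set w = Y" "distinct w" "sorted_wrt precedes w"
proof -
  have Y: "Y \<subseteq> {..<n}" using assms(2) by (auto simp: linear_vars_def)
  show wY: "set w = Y" using represents_set[OF essential assms(1) Y] .
  have "count_list w y = 1" if "y \<in> set w" for y
    using represents_count(2)[OF assms(1) Y] that wY assms(2) by auto
  then show "distinct w" by (simp add: distinct_if_count_list_le_1)
  show "sorted_wrt precedes w"
  proof (rule sorted_wrt_if_splits)
    fix u y v y' assume "w = u @ y # v" "y' \<in> set v"
    then show "precedes y y'"
      using precedes_if_split[OF assms(1) Y, of u y v y'] wY assms(2) by auto
  qed
qed

lemma precedes_total:
  assumes "y \<in> linear_vars" "y' \<in> linear_vars" "y \<noteq> y'"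
  shows "precedes y y' \<or> precedes y' y"
proof -
  have "{y, y'} \<subseteq> {..<n}" using assms by (auto simp: linear_vars_def)
  moreover have "card {y, y'} + 2 \<le> n" using n_ge5 assms(3) by simp
  ultimately obtain w where "represents w {y, y'}" using ex_represents by blast
  then have "set w = {y, y'}" "sorted_wrt precedes w" using represents_linear assms by auto
  then show ?thesis using sorted_wrt_total[of precedes w y y'] assms(3) by auto
qed

lemma precedes_antisym:
  assumes "a \<in> N" "b \<in> N" "a \<otimes> b \<noteq> b \<otimes> a" "y \<noteq> y'" "precedes y y'"
  shows "\<not> precedes y' y"
proof
  assume "precedes y' y"
  then have "F (two_at y' b y a) = b \<otimes> a" using assms by (simp add: precedes_def)
  moreover have "F (two_at y a y' b) = a \<otimes> b" using assms by (simp add: precedes_def)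
  moreover have "two_at y' b y a = two_at y a y' b" using assms(4) by (simp add: fun_upd_twist)
  ultimately show False using assms(3) by simp
qed

lemma precedes_if_commutative:
  assumes "\<And>a b. a \<in> N \<Longrightarrow> b \<in> N \<Longrightarrow> a \<otimes> b = b \<otimes> a"
    and "y \<in> linear_vars" "y' \<in> linear_vars" "y \<noteq> y'"
  shows "precedes y y'"
proof (cases "precedes y y'")
  case False
  then have p: "precedes y' y" using precedes_total assms by blast
  have "F (two_at y a y' b) = a \<otimes> b" if "a \<in> N" "b \<in> N" for a b
  proof -
    have "two_at y a y' b = two_at y' b y a" using assms(4) by (simp add: fun_upd_twist)
    then show ?thesis using p that assms(1) by (simp add: precedes_def)
  qed
  then show ?thesis by (simp add: precedes_def)
qed

text \<open>Over a commutative monoid any two linear variables precede each other. Otherwise two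
  noncommuting elements make the relation antisymmetric, so it is the order of the letters in a
  word that describes \<open>F\<close> on all three variables at once.\<close>

lemma precedes_trans:
  assumes L: "y \<in> linear_vars" "y' \<in> linear_vars" "y'' \<in> linear_vars"
    and d: "distinct [y, y', y'']" and p: "precedes y y'" "precedes y' y''"
  shows "precedes y y''"
proof (cases "\<forall>a\<in>N. \<forall>b\<in>N. a \<otimes> b = b \<otimes> a")
  case True
  then show ?thesis using precedes_if_commutative[of y y''] assms by auto
next
  case False
  then obtain a b where ab: "a \<in> N" "b \<in> N" "a \<otimes> b \<noteq> b \<otimes> a" by blast
  let ?Y = "{y, y', y''}"
  have "?Y \<subseteq> {..<n}" using L by (auto simp: linear_vars_def)
  moreover have "card ?Y + 2 \<le> n" using n_ge5 d by simp
  ultimately obtain w where "represents w ?Y" using ex_represents by blast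
  then have w: "set w = ?Y" "distinct w" "sorted_wrt precedes w"
    using represents_linear[of w ?Y] L by auto
  \<comment> \<open>Positions in \<open>w\<close> reflect the relation because it is antisymmetric here.\<close>
  have order: "i < j" if "i < length w" "j < length w" "w ! i \<noteq> w ! j" "precedes (w ! i) (w ! j)" for i j
  proof (rule ccontr)
    assume "\<not> i < j"
    then have "j < i" using that(3) by (cases "i = j") auto
    then have "precedes (w ! j) (w ! i)" using w(3) that(1) by (simp add: sorted_wrt_iff_nth_less)
    then show False using precedes_antisym[OF ab that(3,4)] by simp
  qed
  have mem: "y \<in> set w" "y' \<in> set w" "y'' \<in> set w" using w(1) by auto
  obtain i where i: "i < length w" "w ! i = y" using mem(1) by (auto simp: in_set_conv_nth)
  obtain j where j: "j < length w" "w ! j = y'" using mem(2) by (auto simp: in_set_conv_nth)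
  obtain k where k: "k < length w" "w ! k = y''" using mem(3) by (auto simp: in_set_conv_nth)
  have "i < j" using order[of i j] i j d p by simp
  also have "j < k" using order[of j k] j k d p by simp
  finally show ?thesis using w(3) i k by (auto simp: sorted_wrt_iff_nth_less)
qed

lemma ex_linear_enumeration:
  "\<exists>ys. distinct ys \<and> set ys = linear_vars \<and> sorted_wrt precedes ys"
proof (rule ex_sorted_wrt_enumeration)
  show "finite linear_vars" by (simp add: linear_vars_def)
qed (use precedes_total precedes_trans in blast)+

lemma ev_eq_zero_if_counts:
  assumes "range a \<subseteq> carrier S" "set w \<subseteq> {..<n}" "Y = {i. i < n \<and> a i \<noteq> \<one>}"
    and "4 \<le> (\<Sum>i\<in>Y. count_list w i)"
  shows "ev a w = z"
proof (rule ev_eq_zero)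
  have "filter (\<lambda>i. i \<in> Y) w = filter (\<lambda>i. a i \<noteq> \<one>) w"
    using assms(2,3) by (intro filter_cong) auto
  moreover have "finite Y" using assms(3) by simp
  ultimately show "4 \<le> length (filter (\<lambda>i. a i \<noteq> \<one>) w)"
    using assms(4) by (simp add: sum_count_list_eq_length_filter)
qed (use assms(1) in auto)

lemma insertion_count_if_split:
  assumes w: "represents w Y" "Y \<subseteq> {..<n}" and x: "x \<in> Y" "x \<noteq> y" and y: "y \<in> Y" "y \<in> linear_vars"
    and "count_list w x = 2"
  shows "count_list (takeWhile (\<lambda>i. i \<noteq> y) w) x \<in> insertion_counts x y"
proof -
  obtain u v where uv: "w = u @ y # v" "y \<notin> set u" "y \<notin> set v"
    using split_at_linear[OF w y] by blast
  have tw: "takeWhile (\<lambda>i. i \<noteq> y) w = u" using uv by (subst uv(1), subst takeWhile_append2) auto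
  have c: "count_list u x + count_list v x = 2" using assms(7) uv x by simp
  have "F (two_at x a y b) = a [^] count_list u x \<otimes> (b \<otimes> a [^] (2 - count_list u x))"
    if "a \<in> N" "b \<in> N" for a b
  proof -
    have "F (two_at x a y b) = ev (two_at x a y b) w"
      using represents_two_at[OF w(1) x(1) y(1) that] .
    also have "\<dots> = a [^] count_list u x \<otimes> (b \<otimes> a [^] count_list v x)"
      unfolding uv(1) using that uv x by (intro ev_two_at) (auto simp: N_carrier)
    also have "count_list v x = 2 - count_list u x" using c by simp
    finally show ?thesis .
  qed
  then show ?thesis using c tw by (simp add: insertion_counts_def)
qed

text \<open>A word with at least three copies of a square variable \<open>x\<close> only arises when squares
  vanish; then both sides of the defining equation are zero.\<close>

lemma zero_insertion_count:
  assumes w: "represents w Y" "Y \<subseteq> {..<n}" and x: "x \<in> Y" "x \<noteq> y" and y: "y \<in> Y"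
    and sq: "x \<in> square_vars" "3 \<le> count_list w x"
  shows "0 \<in> insertion_counts x y"
proof -
  have "F (two_at x a y b) = b \<otimes> (a \<otimes> a)" if "a \<in> N" "b \<in> N" for a b
  proof -
    have ab: "a \<in> carrier S" "b \<in> carrier S" "a \<noteq> \<one>" "b \<noteq> \<one>" using that one_notin by (auto simp: N_carrier)
    have "x < n" "y < n" using w(2) x y by auto
    then have Y: "{x, y} = {i. i < n \<and> two_at x a y b i \<noteq> \<one>}" using ab by auto
    have "F (two_at x a y b) = ev (two_at x a y b) w"
      using represents_two_at[OF w(1) x(1) y that] .
    also have "\<dots> = z"
    proof (rule ev_eq_zero_if_counts[OF _ _ Y])
      show "set w \<subseteq> {..<n}" using represents_set[OF essential w] w(2) by simp
      show "4 \<le> (\<Sum>i\<in>{x, y}. count_list w i)"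
        using x(2) sq(2) represents_count(1)[OF w y] by simp
    qed (use ab in auto)
    also have "z = b \<otimes> (a \<otimes> a)"
      using represents_count(4)[OF w x(1) sq that(1)] ab z_absorb by simp
    finally show ?thesis .
  qed
  then show ?thesis by (auto simp: insertion_counts_def N_carrier numeral_2_eq_2)
qed

text \<open>All the data on one square variable \<open>x\<close> and at most three linear variables come from a
  single word, and in an actual word the number of copies of \<open>x\<close> in front of a letter increases
  from left to right. The word has four variables, so its existence needs \<open>6 \<le> n\<close>; the
  noncommuting pair, which makes the order of the linear variables strict, also provides this by
  forcing \<open>N\<close> to have at least three elements.\<close>

lemma ex_selection_short:
  assumes ab: "a \<in> N" "b \<in> N" "a \<otimes> b \<noteq> b \<otimes> a" and x: "x \<in> square_vars"
    and t: "distinct t" "sorted_wrt precedes t" "set t \<subseteq> linear_vars" "length t \<le> 3"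
  shows "\<exists>p. sorted_wrt (\<lambda>y y'. p y \<le> p y') t \<and> (\<forall>y\<in>set t. 0 \<le> p y \<and> p y \<in> insertion_counts x y)"
proof -
  let ?Y = "insert x (set t)"
  have xt: "x \<notin> set t" using square_not_linear[OF x] t(3) by auto
  have Yn: "?Y \<subseteq> {..<n}" using x t(3) by (auto simp: linear_vars_def square_vars_def)
  have "3 \<le> card N"
  proof -
    have "a \<noteq> b" "a \<noteq> z" "b \<noteq> z" using ab z_absorb by (auto simp: N_carrier)
    then have "card {a, b, z} = 3" by simp
    moreover have "card {a, b, z} \<le> card N" by (rule card_mono) (use ab z_in finite_N in auto)
    ultimately show ?thesis by simp
  qed
  then have "card ?Y + 2 \<le> n" using n_ge t(4) card_length[of t] xt by simp
  then obtain w where w: "represents w ?Y" using ex_represents Yn by blast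
  show ?thesis
  proof (cases "count_list w x = 2")
    case True
    define p where "p = (\<lambda>y. count_list (takeWhile (\<lambda>i. i \<noteq> y) w) x)"
    have "p y \<in> insertion_counts x y" if "y \<in> set t" for y
      unfolding p_def using insertion_count_if_split[OF w Yn, of x y] that xt t(3) True by auto
    moreover have "p y \<le> p y'"
      if y: "y \<in> set t" "y' \<in> set t" "y \<noteq> y'" "precedes y y'" for y y'
    proof -
      have L: "y \<in> linear_vars" "y' \<in> linear_vars" using y t(3) by auto
      obtain u v where uv: "w = u @ y # v" "y \<notin> set u"
        using split_at_linear[OF w Yn _ L(1)] y by blast
      have "y' \<notin> set u"
      proof
        assume "y' \<in> set u"
        then obtain u1 u2 where "u = u1 @ y' # u2" by (blast dest: split_list)
        then have "precedes y' y"
          using precedes_if_split[OF w Yn, of u1 y' "u2 @ y # v" y] uv L by simp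
        then show False using precedes_antisym[OF ab y(3,4)] by simp
      qed
      then have "takeWhile (\<lambda>i. i \<noteq> y') w = u @ takeWhile (\<lambda>i. i \<noteq> y') (y # v)"
        by (subst uv(1), subst takeWhile_append2) auto
      moreover have "takeWhile (\<lambda>i. i \<noteq> y) w = u"
        using uv by (subst uv(1), subst takeWhile_append2) auto
      ultimately show ?thesis unfolding p_def by (simp only: count_list_append le_add1)
    qed
    then have "sorted_wrt (\<lambda>y y'. p y \<le> p y') t"
      using t(1,2)
    proof (induction t)
      case (Cons c t)
      then show ?case by fastforce
    qed simp
    ultimately show ?thesis by blast
  next
    case False
    then have "3 \<le> count_list w x"
      using represents_count(1,2)[OF w Yn, of x] square_not_linear[OF x] by auto
    then have "0 \<in> insertion_counts x y" if "y \<in> set t" for y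
      using zero_insertion_count[OF w Yn, of x y] that xt x by auto
    moreover have "sorted_wrt (\<lambda>y y'. (0::nat) \<le> 0) t" by (induction t) auto
    ultimately show ?thesis by (intro exI[of _ "\<lambda>_. 0"]) simp
  qed
qed

text \<open>The insertion counts lie in \<open>{0, 1, 2}\<close>, so the Helly property reduces the whole list of
  linear variables to sublists of length three. Over a commutative monoid all counts are
  equivalent and zero is always admissible.\<close>

lemma ex_selection:
  assumes x: "x \<in> square_vars" and ys: "distinct ys" "sorted_wrt precedes ys" "set ys = linear_vars"
  shows "\<exists>p. sorted_wrt (\<lambda>y y'. p y \<le> p y') ys \<and> (\<forall>y\<in>linear_vars. p y \<in> insertion_counts x y)"
proof (cases "\<forall>a\<in>N. \<forall>b\<in>N. a \<otimes> b = b \<otimes> a")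
  case False
  then obtain a b where ab: "a \<in> N" "b \<in> N" "a \<otimes> b \<noteq> b \<otimes> a" by blast
  have "\<exists>p. sorted_wrt (\<lambda>y y'. p y \<le> p y') ys \<and> (\<forall>y\<in>set ys. 0 \<le> p y \<and> p y \<in> insertion_counts x y)"
  proof (rule monotone_selection[where P = precedes and m = 2])
    show "insertion_counts x y \<subseteq> {..2}" for y by (auto simp: insertion_counts_def)
  qed (use ys ex_selection_short[OF ab x] in auto)
  then show ?thesis using ys(3) by auto
next
  case True
  have "0 \<in> insertion_counts x y" if y: "y \<in> linear_vars" for y
  proof -
    have xy: "x \<noteq> y" using square_not_linear[OF x] y by auto
    have Y: "{x, y} \<subseteq> {..<n}" using x y by (auto simp: square_vars_def linear_vars_def)
    moreover have "card {x, y} + 2 \<le> n" using n_ge5 xy by simp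
    ultimately obtain w where w: "represents w {x, y}" using ex_represents by blast
    show ?thesis
    proof (cases "count_list w x = 2")
      case c: True
      let ?q = "count_list (takeWhile (\<lambda>i. i \<noteq> y) w) x"
      have q: "?q \<in> insertion_counts x y"
        using insertion_count_if_split[OF w Y _ xy _ y c] by simp
      have "a [^] ?q \<otimes> (b \<otimes> a [^] (2 - ?q)) = b \<otimes> a [^] (2::nat)" if "a \<in> N" "b \<in> N" for a b
      proof -
        have ab: "a \<in> carrier S" "b \<in> carrier S" "b \<otimes> a = a \<otimes> b" using that True by (auto simp: N_carrier)
        have com: "a [^] k \<otimes> b = b \<otimes> a [^] k" for k :: nat
          using ab by (simp add: group_commutes_pow)
        have "a [^] ?q \<otimes> (b \<otimes> a [^] (2 - ?q)) = b \<otimes> (a [^] ?q \<otimes> a [^] (2 - ?q))"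
          using ab com by (simp flip: m_assoc)
        also have "a [^] ?q \<otimes> a [^] (2 - ?q) = a [^] (?q + (2 - ?q))"
          using ab by (simp add: nat_pow_mult)
        also have "?q + (2 - ?q) = 2" using q by (simp add: insertion_counts_def)
        finally show ?thesis .
      qed
      then show ?thesis using q by (simp add: insertion_counts_def N_carrier)
    next
      case False
      then have "3 \<le> count_list w x"
        using represents_count(1,2)[OF w Y, of x] square_not_linear[OF x] by auto
      then show ?thesis using zero_insertion_count[OF w Y, of x y] xy x by simp
    qed
  qed
  moreover have "sorted_wrt (\<lambda>y y'. (0::nat) \<le> 0) ys" by (induction ys) auto
  ultimately show ?thesis by (intro exI[of _ "\<lambda>_. 0"]) simp
qed

text \<open>If two coordinates outside the support exist, then the support is described by a word with
  at least four letters. Otherwise the support is larger than \<open>N\<close>, so two of its coordinates \<open>i\<close>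
  and \<open>j\<close> carry the same value and a minor applies. Its word contains all the other variables of
  the support; the point to check is that \<open>i\<close> and \<open>j\<close> together also contribute at least two
  letters. This follows by comparison with a word that describes \<open>F\<close> on \<open>i\<close> and \<open>j\<close> alone and
  contains both of them: fewer than two letters would give \<open>b\<^sup>k = b\<close> or \<open>b\<^sup>k = \<one>\<close> on \<open>N\<close> for some
  \<open>k \<ge> 2\<close>.\<close>

lemma F_large_support:
  assumes a: "range a \<subseteq> carrier S" and Y: "Y = {i. i < n \<and> a i \<noteq> \<one>}" and card: "4 \<le> card Y"
  shows "F a = z"
proof -
  have Yn: "Y \<subseteq> {..<n}" "finite Y" using Y by auto
  show ?thesis
  proof (cases "card Y + 2 \<le> n")
    case True
    then obtain w where w: "represents w Y" using ex_represents Yn by blast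
    have wY: "set w = Y" using represents_set[OF essential w Yn(1)] .
    have "F a = ev a w" by (rule representsD[OF w a]) (use Y in auto)
    also have "\<dots> = z"
      by (rule ev_eq_zero_if_counts[OF a _ Y]) (use wY Yn(1) card_le_sum_count_list[of Y w] card in auto)
    finally show ?thesis .
  next
    case False
    have aN: "a ` Y \<subseteq> N" using a Y carrier_eq by auto
    have "card N < card Y" using False n_ge by simp
    then obtain i j where ij: "i \<in> Y" "j \<in> Y" "i \<noteq> j" "a i = a j"
      using repeated_value[OF aN finite_N] by blast
    then obtain w where w: "set w \<subseteq> {..<n}"
      "\<And>a. range a \<subseteq> carrier S \<Longrightarrow> a i = a j \<Longrightarrow> F a = ev a w"
      using minors[of i j] Yn(1) by blast
    have Yij: "{i, j} \<subseteq> {..<n}" using ij Yn(1) by auto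
    moreover have "card {i, j} + 2 \<le> n" using n_ge5 ij by simp
    ultimately obtain v where v: "represents v {i, j}" using ex_represents by blast
    have two: "2 \<le> count_list w i + count_list w j"
    proof (rule ccontr)
      assume "\<not> ?thesis"
      then have c: "count_list w i + count_list w j < 2" by simp
      let ?k = "count_list v i + count_list v j"
      have k: "2 \<le> ?k" using represents_count(1)[OF v Yij, of i] represents_count(1)[OF v Yij, of j] by simp
      have pow: "b [^] ?k = b [^] (count_list w i + count_list w j)" if b: "b \<in> N" for b
      proof -
        let ?a = "two_at i b j b"
        have eq: "ev ?a u = b [^] (count_list u i + count_list u j)" for u
          using ev_two_at_equal ij(3) b by (simp add: N_carrier)
        have "ev ?a v = F ?a" using represents_two_at[OF v, of i j b b] b by simp
        also have "F ?a = ev ?a w" by (rule w(2)) (use b ij in \<open>auto simp: N_carrier\<close>)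
        finally show ?thesis using eq by simp
      qed
      obtain b where b: "b \<in> N" "b [^] ?k \<noteq> b" using non_idempotent[OF k] .
      have "count_list w i + count_list w j = 0"
        using c pow[OF b(1)] b by (cases "count_list w i + count_list w j") (auto simp: N_carrier)
      then have "b [^] ?k = \<one>" using pow[OF b(1)] by simp
      moreover have "b [^] ?k \<in> N" 
        using power_in_N[OF b(1)] k by simp
      ultimately show False using one_notin by simp
    qed
    have "l \<in> set w" if "l \<in> Y - {i, j}" for l
      by (rule essential_occurs[OF essential _ _ _ _ _ w(2)]) (use that ij Yn(1) in auto)
    then have "card (Y - {i, j}) \<le> (\<Sum>l\<in>Y - {i, j}. count_list w l)"
      by (intro card_le_sum_count_list) blast
    moreover have "card (Y - {i, j}) = card Y - 2" using ij Yn(2) by (simp add: card_Diff_subset)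
    moreover have "(\<Sum>l\<in>Y. count_list w l) = (\<Sum>l\<in>Y - {i, j}. count_list w l) + (\<Sum>l\<in>{i, j}. count_list w l)"
      by (rule sum.subset_diff) (use ij Yn(2) in auto)
    ultimately have "4 \<le> (\<Sum>l\<in>Y. count_list w l)" using two ij(3) card by simp
    then have "ev a w = z" by (rule ev_eq_zero_if_counts[OF a w(1) Y])
    then show ?thesis using w(2)[OF a ij(4)] by simp
  qed
qed

text \<open>Both sides are the unordered product of the values of \<open>a\<close> over the letters.\<close>

lemma ev_eq_if_commutative:
  assumes "\<And>a b. a \<in> N \<Longrightarrow> b \<in> N \<Longrightarrow> a \<otimes> b = b \<otimes> a" "range a \<subseteq> carrier S"
    and "distinct u" "distinct v" "set u = set v"
  shows "ev a u = ev a v"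
proof -
  interpret comm_monoid S
    by unfold_locales (use assms(1) carrier_eq in auto)
  have "ev a w = finprod S a (set w)" if "distinct w" for w
    using that
  proof (induction w)
    case (Cons i w)
    have "a ` set (i # w) \<subseteq> carrier S" using assms(2) by auto
    then show ?case using Cons by (simp add: finprod_insert Pi_def image_subset_iff)
  qed simp
  then show ?thesis using assms(3-5) by simp
qed

text \<open>The word is obtained by inserting the nonlinear variables into the list of linear ones: a
  square variable according to a monotone choice of insertion counts, any other nonlinear
  variable entirely at the end. The word agrees with \<open>F\<close> because a nonzero value requires at
  most three letters to survive, and the surviving letters then form one of the patterns that
  were matched: distinct linear variables, a power of one variable, or two copies of a square
  variable and one linear variable.\<close>

lemma ex_word_if_essential:
  "\<exists>w. w \<noteq> [] \<and> set w \<subseteq> {..<n} \<and> (\<forall>a. range a \<subseteq> carrier S \<longrightarrow> F a = ev a w)"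
proof -
  let ?L = linear_vars and ?X = "{..<n} - linear_vars"
  obtain ys where ys: "distinct ys" "set ys = ?L" "sorted_wrt precedes ys"
    using ex_linear_enumeration by blast
  \<comment> \<open>Square variables need the exponent two, because insertion counts presuppose two copies; if
    squares vanish, then a larger exponent would describe the same unary function.\<close>
  define exponent where "exponent x k \<longleftrightarrow> (\<forall>b\<in>N. F (one_at x b) = b [^] k) \<and> 2 \<le> k \<and>
      (x \<in> square_vars \<longrightarrow> k = 2) \<and> (x \<notin> square_vars \<longrightarrow> 3 \<le> k)" for x and k :: nat
  have ex_tot: "\<exists>k. exponent x k" if x: "x \<in> ?X" for x
  proof (cases "x \<in> square_vars")
    case True
    then show ?thesis
      by (intro exI[of _ "2::nat"]) (simp add: exponent_def square_vars_def numeral_2_eq_2 N_carrier)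
  next
    case False
    have xn: "{x} \<subseteq> {..<n}" using x by simp
    moreover have "card {x} + 2 \<le> n" using n_ge5 by simp
    ultimately obtain w where w: "represents w {x}" using ex_represents by blast
    have "3 \<le> count_list w x" using represents_count(3)[OF w xn, of x] x False by simp
    then show ?thesis using represents_one_at[OF w, of x] False
      by (intro exI[of _ "count_list w x"]) (auto simp: exponent_def)
  qed
  then obtain tot where "\<And>x. x \<in> ?X \<Longrightarrow> exponent x (tot x)" by metis
  then have tot_F: "F (one_at x b) = b [^] tot x"
    and tot: "2 \<le> tot x" "x \<in> square_vars \<Longrightarrow> tot x = 2" "x \<notin> square_vars \<Longrightarrow> 3 \<le> tot x"
    if "x \<in> ?X" "b \<in> N" for x b
    using that by (simp_all add: exponent_def)
  note tot = tot[OF _ z_in]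
  \<comment> \<open>Only square variables interact with linear ones; the copies of all the others are put at
    the end.\<close>
  define admissible where "admissible x q \<longleftrightarrow> sorted_wrt (\<lambda>y y'. q y \<le> q y') ys \<and>
      (x \<in> square_vars \<longrightarrow> (\<forall>y\<in>?L. q y \<in> insertion_counts x y)) \<and>
      (x \<notin> square_vars \<longrightarrow> q = (\<lambda>_. 0))" for x q
  have "\<exists>q. admissible x q" for x
  proof (cases "x \<in> square_vars")
    case True
    then show ?thesis using ex_selection[OF True ys(1,3,2)] by (simp add: admissible_def)
  next
    case False
    have "sorted_wrt (\<lambda>y y'. (0::nat) \<le> 0) ys" by (induction ys) auto
    then show ?thesis using False by (simp add: admissible_def)
  qed
  then obtain p where "\<And>x. admissible x (p x)" by metis
  then have p: "sorted_wrt (\<lambda>y y'. p x y \<le> p x y') ys"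
    "x \<in> square_vars \<Longrightarrow> y \<in> ?L \<Longrightarrow> p x y \<in> insertion_counts x y"
    "x \<notin> square_vars \<Longrightarrow> p x = (\<lambda>_. 0)" for x y
    by (simp_all add: admissible_def)
  have ptot: "p x y \<le> tot x" if "x \<in> ?X" "y \<in> ?L" for x y
    using p(2)[of x y] p(3)[of x] tot[of x] that by (cases "x \<in> square_vars") (auto simp: insertion_counts_def)
  have "\<exists>w. set w \<subseteq> ?X \<union> set ys \<and> filter (\<lambda>i. i \<in> ?L) w = ys \<and>
    (\<forall>x\<in>?X. count_list w x = tot x - (\<lambda>_. 0) x \<and>
      (\<forall>y\<in>set ys. count_list (takeWhile (\<lambda>i. i \<noteq> y) w) x = p x y - (\<lambda>_. 0) x))"
    by (rule ex_interleaving) (use ys p(1) ptot in auto)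
  then obtain w where w: "set w \<subseteq> ?X \<union> set ys" "filter (\<lambda>i. i \<in> ?L) w = ys"
    and cX: "\<And>x. x \<in> ?X \<Longrightarrow> count_list w x = tot x"
    and before: "\<And>x y. x \<in> ?X \<Longrightarrow> y \<in> ?L \<Longrightarrow> count_list (takeWhile (\<lambda>i. i \<noteq> y) w) x = p x y"
    using ys(2) by auto
  have Ln: "?L \<subseteq> {..<n}" by (auto simp: linear_vars_def)
  have cL: "count_list w y = 1" if "y \<in> ?L" for y
    using count_list_filter[of "\<lambda>i. i \<in> ?L" y w] count_list_eq_1_if_distinct[of ys y] that ys w(2) by simp
  have c1: "1 \<le> count_list w i" if "i < n" for i
    using cL[of i] cX[of i] tot(1)[of i] that by (cases "i \<in> ?L") auto
  have wn: "set w = {..<n}"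
  proof
    show "set w \<subseteq> {..<n}" using w(1) ys(2) Ln by auto
    show "{..<n} \<subseteq> set w"
    proof
      fix i assume "i \<in> {..<n}"
      then have "count_list w i \<noteq> 0" using c1[of i] by simp
      then show "i \<in> set w" by (simp add: count_list_0_iff)
    qed
  qed
  have "F a = ev a w" if a: "range a \<subseteq> carrier S" for a
  proof -
    define Y where Y: "Y = {i. i < n \<and> a i \<noteq> \<one>}"
    have Yn: "Y \<subseteq> {..<n}" "finite Y" using Y by auto
    have aY: "a i \<in> N" if "i \<in> Y" for i using that a Y carrier_eq by auto
    have ac: "a i \<in> carrier S" for i using a by auto
    have off: "a i = \<one>" if "i < n" "i \<notin> Y" for i using that Y by simp
    consider "4 \<le> card Y" | "Y \<subseteq> ?L" "card Y \<le> 3" | x where "card Y \<le> 3" "x \<in> Y" "x \<notin> ?L" by fastforce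
    then show ?thesis
    proof cases
      case 1
      have "4 \<le> (\<Sum>i\<in>Y. count_list w i)" using card_le_sum_count_list[of Y w] Yn(1) wn 1 by simp
      then have "ev a w = z" using ev_eq_zero_if_counts[OF a _ Y] wn by simp
      then show ?thesis using F_large_support[OF a Y 1] by simp
    next
      case 2
      have "card Y + 2 \<le> n" using 2(2) n_ge5 by simp
      then obtain v where v: "represents v Y" using ex_represents Yn by blast
      have lin: "set v = Y" "distinct v" "sorted_wrt precedes v" using represents_linear[OF v 2(1)] .
      let ?u = "filter (\<lambda>i. i \<in> Y) w"
      have "?u = filter (\<lambda>i. i \<in> Y) (filter (\<lambda>i. i \<in> ?L) w)"
        unfolding filter_filter using 2(1) by (intro filter_cong) auto
      then have u: "set ?u = Y" "distinct ?u" "sorted_wrt precedes ?u"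
        using w(2) ys 2(1) by (auto intro: sorted_wrt_filter)
      have "F a = ev a v" by (rule representsD[OF v a]) (use Y in auto)
      also have "ev a v = ev a ?u"
      proof (cases "\<forall>a\<in>N. \<forall>b\<in>N. a \<otimes> b = b \<otimes> a")
        case True
        show ?thesis
          by (rule ev_eq_if_commutative) (use True a lin u in auto)
      next
        case False
        then obtain a b where ab: "a \<in> N" "b \<in> N" "a \<otimes> b \<noteq> b \<otimes> a" by blast
        have "v = ?u"
          by (rule sorted_wrt_unique[where P = precedes])
            (use lin u precedes_antisym[OF ab] in simp_all)
        then show ?thesis by simp
      qed
      also have "ev a ?u = ev a w" by (rule ev_filter) (use ac wn Y in auto)
      finally show ?thesis .
    next
      case (3 x)
      have xX: "x \<in> ?X" using 3 Yn by auto
      have "card Y + 2 \<le> n" using 3(1) n_ge5 by simp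
      then obtain v where v: "represents v Y" using ex_represents Yn by blast
      \<comment> \<open>A nonlinear \<open>x\<close> in the support: apart from two matched patterns, at least four letters
        survive.\<close>
      consider "Y = {x}" | y where "Y = {x, y}" "x \<in> square_vars" "y \<in> ?L"
        | y where "y \<in> Y" "x \<noteq> y" "3 \<le> card Y \<or> x \<notin> square_vars \<or> y \<notin> ?L"
      proof (cases "Y = {x}")
        case False
        then obtain y where y: "y \<in> Y" "x \<noteq> y" using 3(2) by blast
        show ?thesis
        proof (cases "3 \<le> card Y")
          case False
          have "card {x, y} = 2" using y by simp
          then have "Y = {x, y}"
            using False card_seteq[OF Yn(2), of "{x, y}"] y 3(2) by simp
          then show ?thesis using y that by blast
        qed (use y that in blast)
      qed (use that in blast)
      then show ?thesis
      proof cases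
        case 1
        have ones: "a i = \<one>" if "i < n" "i \<noteq> x" for i using off[of i] 1 that by simp
        have "F a = F (one_at x (a x))" by (rule F_cong) (use ones in auto)
        also have "\<dots> = a x [^] tot x" using tot_F xX aY 3(2) by simp
        also have "\<dots> = ev a w" using ev_power[of a x w] ac ones wn cX[OF xX] by auto
        finally show ?thesis .
      next
        case (2 y)
        let ?a = "two_at x (a x) y (a y)"
        have xy: "x \<noteq> y" using 2(3) 3(3) by auto
        have y: "y \<in> Y" using 2(1) by simp
        have agree: "a i = ?a i" if "i < n" for i
        proof (cases "i \<in> Y")
          case False
          then show ?thesis using off[of i] that 2(1) by simp
        qed (use 2(1) in auto)
        have "y \<in> set w" using wn y Yn by auto
        then obtain u t where ut: "w = u @ y # t" "y \<notin> set u" by (blast dest: split_list_first)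
        have yt: "y \<notin> set t"
        proof
          assume "y \<in> set t"
          then show False using one_le_count_list[of y t] cL[OF 2(3)] ut(1) by simp
        qed
        have "takeWhile (\<lambda>i. i \<noteq> y) w = u" using ut by (subst ut(1), subst takeWhile_append2) auto
        then have cu: "count_list u x = p x y" using before[OF xX 2(3)] by simp
        have ct: "count_list t x = 2 - p x y" using cX[OF xX] tot(2)[OF xX 2(2)] cu ut(1) xy by simp
        have "F a = F ?a" by (rule F_cong) (rule agree)
        also have "\<dots> = a x [^] p x y \<otimes> (a y \<otimes> a x [^] (2 - p x y))"
          using p(2)[OF 2(2,3)] aY 3(2) y by (auto simp: insertion_counts_def)
        also have "\<dots> = ev ?a w"
          unfolding ut(1) using ev_two_at[of "a x" "a y" x y u t] ac xy ut(2) yt cu ct by simp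
        also have "ev ?a w = ev a w" by (rule ev_cong) (use agree wn in auto)
        finally show ?thesis .
      next
        case (3 y)
        note y = this
        have big: "4 \<le> (\<Sum>i\<in>Y. c i)"
          if c: "\<And>i. i \<in> Y \<Longrightarrow> 1 \<le> c i" "\<And>i. i \<in> Y \<Longrightarrow> i \<notin> ?L \<Longrightarrow> 2 \<le> c i"
            "\<And>i. i \<in> Y \<Longrightarrow> i \<notin> ?L \<Longrightarrow> i \<notin> square_vars \<Longrightarrow> 3 \<le> c i" for c :: "nat \<Rightarrow> nat"
        proof -
          have xY: "x \<in> Y" "x \<notin> ?L" using \<open>x \<in> Y\<close> \<open>x \<notin> ?L\<close> .
          have "(\<Sum>i\<in>Y. c i) = (\<Sum>i\<in>Y - {x, y}. c i) + (\<Sum>i\<in>{x, y}. c i)"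
            by (rule sum.subset_diff) (use xY y Yn in auto)
          moreover have "(\<Sum>i\<in>Y - {x, y}. 1) \<le> (\<Sum>i\<in>Y - {x, y}. c i)"
            by (rule sum_mono) (use c(1) in auto)
          moreover have "card (Y - {x, y}) = card Y - 2" using xY y Yn by (simp add: card_Diff_subset)
          moreover have "1 \<le> c y" "2 \<le> c x" "y \<notin> ?L \<Longrightarrow> 2 \<le> c y" "x \<notin> square_vars \<Longrightarrow> 3 \<le> c x"
            using c xY y by auto
          ultimately show ?thesis using y(2,3) by auto
        qed
        have "4 \<le> (\<Sum>i\<in>Y. count_list w i)"
        proof (rule big)
          fix i assume i: "i \<in> Y"
          then show "1 \<le> count_list w i" using c1 Yn by auto
          show "2 \<le> count_list w i" if "i \<notin> ?L" using cX[of i] tot(1)[of i] that i Yn by auto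
          show "3 \<le> count_list w i" if "i \<notin> ?L" "i \<notin> square_vars"
            using cX[of i] tot(3)[of i] that i Yn by auto
        qed
        then have wz: "ev a w = z" using ev_eq_zero_if_counts[OF a _ Y] wn by simp
        have "4 \<le> (\<Sum>i\<in>Y. count_list v i)"
        proof (rule big)
          fix i assume i: "i \<in> Y"
          note c = represents_count[OF v Yn(1) i]
          show "1 \<le> count_list v i" by (rule c)
          show "2 \<le> count_list v i" if "i \<notin> ?L" using c(1,2) that by linarith
          show "3 \<le> count_list v i" if "i \<notin> ?L" "i \<notin> square_vars" using c(3) that by simp
        qed
        moreover have "set v \<subseteq> {..<n}" using represents_set[OF essential v Yn(1)] Yn by simp
        ultimately have "ev a v = z" using ev_eq_zero_if_counts[OF a _ Y] by simp
        moreover have "F a = ev a v" by (rule representsD[OF v a]) (use Y in auto)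
        ultimately show ?thesis using wz by simp
      qed
    qed
  qed
  moreover have "0 \<in> set w" unfolding wn using n_ge5 by simp
  then have "w \<noteq> []" by (metis empty_iff empty_set)
  ultimately show ?thesis using equalityD1[OF wn] by blast
qed

end

section \<open>The degree bound\<close>

context nilpotent4_minors
begin

lemma ex_word:
  "\<exists>w. w \<noteq> [] \<and> set w \<subseteq> {..<n} \<and> (\<forall>a. range a \<subseteq> carrier S \<longrightarrow> F a = ev a w)"
proof (cases "\<exists>l<n. F (one_at l z) = \<one>")
  case True
  then show ?thesis using ex_word_if_inessential by blast
next
  case False
  then have essential: "F (one_at l z) \<noteq> \<one>" if "l < n" for l using that by blast
  show ?thesis
  proof (cases "N = {z}")
    case True
    have "[0..<n] \<noteq> []" using n_ge4 by simp
    moreover have "set [0..<n] \<subseteq> {..<n}" by auto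
    ultimately show ?thesis using word_if_N_trivial[OF essential True] by blast
  next
    case False
    interpret nilpotent4_essential S N z n F
      by unfold_locales (use essential False in auto)
    show ?thesis by (rule ex_word_if_essential)
  qed
qed

end

lemma (in nilpotent4) semigroup_prod_eq_ev:
  assumes "w \<noteq> []" "\<And>i. i \<in> set w \<Longrightarrow> a i \<in> carrier S"
  shows "semigroup_prod (mult S) (map a w) = ev a w"
  using assms
proof (induction w)
  case (Cons i w)
  show ?case
  proof (cases w)
    case (Cons j v)
    then show ?thesis using Cons.IH Cons.prems by simp
  qed (use Cons.prems in simp)
qed simp

lemma (in nilpotent4) term_function_eq_ev:
  assumes "w \<in> terms n" "xs \<in> tuples n (carrier S)"
  shows "term_function (carrier S) (mult S) n w xs = ev (\<lambda>i. xs ! i) w"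
proof -
  have "xs ! i \<in> carrier S" if "i \<in> set w" for i
    using assms that by (auto simp: terms_def tuples_def subset_iff)
  then show ?thesis
    using assms by (simp add: term_function_def terms_def semigroup_prod_eq_ev)
qed

text \<open>Passing from operations on tuples to functions of valuations. A valuation takes the value
  \<open>\<one>\<close> beyond the arity, which keeps it inside the carrier.\<close>

lemma (in nilpotent4) term_if_minors:
  assumes n: "card N + 3 \<le> n" and f: "f \<in> operations n (carrier S)"
    and min: "\<And>i j. i < j \<Longrightarrow> j < n \<Longrightarrow>
      identify (carrier S) n f i j \<in> term_functions (carrier S) (mult S) n"
  shows "f \<in> term_functions (carrier S) (mult S) n"
proof -
  let ?F = "\<lambda>a. f (map a [0..<n])"
  have tup: "map a [0..<n] \<in> tuples n (carrier S)" if "range a \<subseteq> carrier S" for a :: "nat \<Rightarrow> 'a"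
    using that by (auto simp: tuples_def)
  have minor_words: "\<exists>w. w \<noteq> [] \<and> set w \<subseteq> {..<n} \<and>
      (\<forall>a. range a \<subseteq> carrier S \<longrightarrow> a i = a j \<longrightarrow> ?F a = ev a w)" if ij: "i < j" "j < n" for i j
  proof -
    obtain w where w: "w \<in> terms n"
      and eq: "identify (carrier S) n f i j = term_function (carrier S) (mult S) n w"
      using min[OF ij] by (auto simp: term_functions_def)
    have "?F a = ev a w" if a: "range a \<subseteq> carrier S" "a i = a j" for a
    proof -
      let ?xs = "map a [0..<n]"
      have "?xs[i := ?xs ! j] = ?xs" using a(2) ij by (intro list_update_same_conv[THEN iffD2]) auto
      then have "?F a = identify (carrier S) n f i j ?xs"
        using tup[OF a(1)] by (simp add: identify_def)
      also have "\<dots> = ev (\<lambda>i. ?xs ! i) w" using eq term_function_eq_ev[OF w tup[OF a(1)]] by simp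
      also have "\<dots> = ev a w" by (rule ev_cong) (use w in \<open>auto simp: terms_def\<close>)
      finally show ?thesis .
    qed
    then show ?thesis using w by (auto simp: terms_def)
  qed
  interpret nilpotent4_minors S N z n ?F
  proof
    show "?F a = ?F b" if "\<And>i. i < n \<Longrightarrow> a i = b i" for a b
    proof -
      have "map a [0..<n] = map b [0..<n]" using that by simp
      then show ?thesis by (rule arg_cong)
    qed
    show "\<exists>w. w \<noteq> [] \<and> set w \<subseteq> {..<n} \<and>
      (\<forall>a. range a \<subseteq> carrier S \<longrightarrow> a i = a j \<longrightarrow> ?F a = ev a w)" if "i < n" "j < n" "i \<noteq> j" for i j
    proof (cases "i < j")
      case False
      then have "j < i" using that by simp
      then show ?thesis using minor_words[OF _ that(1), of j] by (simp add: eq_commute[of "_ i"])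
    qed (use minor_words that in blast)
  qed (rule n)
  obtain w where w: "w \<in> terms n" and F: "\<And>a. range a \<subseteq> carrier S \<Longrightarrow> ?F a = ev a w"
    using ex_word unfolding terms_def by blast
  have "f xs = term_function (carrier S) (mult S) n w xs" for xs
  proof (cases "xs \<in> tuples n (carrier S)")
    case True
    define a where "a = (\<lambda>i. if i < n then xs ! i else \<one>)"
    have "range a \<subseteq> carrier S" using True by (auto simp: a_def tuples_def subset_iff)
    moreover have "map a [0..<n] = xs"
      using True by (intro nth_equalityI) (auto simp: a_def tuples_def)
    ultimately have "f xs = ev a w" using F by metis
    also have "\<dots> = ev (\<lambda>i. xs ! i) w"
      by (rule ev_cong) (use w in \<open>auto simp: a_def terms_def\<close>)
    finally show ?thesis using term_function_eq_ev[OF w True] by simp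
  next
    case False
    then show ?thesis using f by (auto simp: term_function_def operations_def PiE_def extensional_def)
  qed
  then have "f = term_function (carrier S) (mult S) n w" by blast
  then show ?thesis using w by (auto simp: term_functions_def)
qed

text \<open>The one-element monoid, where \<open>N\<close> is empty and there is no zero to work with.\<close>

lemma determined_by_minors_trivial:
  "determined_by_minors {e} m k" if "m e e = e"
  unfolding determined_by_minors_def
proof (intro allI ballI impI)
  fix n f assume n: "k < n" and f: "f \<in> operations n {e}"
  have "f xs = term_function {e} m n [0] xs" for xs
  proof (cases "xs \<in> tuples n {e}")
    case True
    then have "f xs = e" using f by (auto simp: operations_def)
    moreover have "xs ! 0 \<in> set xs" using True n by (intro nth_mem) (simp add: tuples_def)
    then have "xs ! 0 = e" using True by (auto simp: tuples_def)
    ultimately show ?thesis using True by (simp add: term_function_def)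
  next
    case False
    then show ?thesis using f by (auto simp: term_function_def operations_def PiE_def extensional_def)
  qed
  then have "f = term_function {e} m n [0]" by blast
  moreover have "[0] \<in> terms n" using n by (simp add: terms_def)
  ultimately show "f \<in> term_functions {e} m n" by (auto simp: term_functions_def)
qed

lemma determined_by_minors_nilpotent_monoid:
  fixes S :: "('a, 'b) monoid_scheme"
  assumes "nilpotent_monoid 4 S" and fin: "finite (carrier S)"
  shows "determined_by_minors (carrier S) (mult S) (card (carrier S) + 1)"
proof -
  obtain N where mon: "monoid S" and N: "\<one>\<^bsub>S\<^esub> \<notin> N" "carrier S = insert \<one>\<^bsub>S\<^esub> N"
    and nilp: "nilpotent_semigroup 4 N (mult S)"
    using assms(1) by (auto simp: nilpotent_monoid_def)
  interpret monoid S by (rule mon)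
  show ?thesis
  proof (cases "N = {}")
    case True
    then show ?thesis using determined_by_minors_trivial[of "mult S" "\<one>\<^bsub>S\<^esub>"] N by simp
  next
    case False
    then obtain b where b: "b \<in> N" by blast
    let ?z = "semigroup_prod (mult S) [b, b, b, b]"
    have sg: "semigroup_on N (mult S)"
      and eq: "\<And>xs ys. xs \<in> tuples 4 N \<Longrightarrow> ys \<in> tuples 4 N \<Longrightarrow>
        semigroup_prod (mult S) xs = semigroup_prod (mult S) ys"
      using nilp unfolding nilpotent_semigroup_def by blast+
    interpret nilpotent4 S N ?z
    proof
      show "?z \<in> N" using semigroup_prod_closed[OF sg, of "[b, b, b, b]"] b by simp
      show "a \<otimes>\<^bsub>S\<^esub> (b' \<otimes>\<^bsub>S\<^esub> (c \<otimes>\<^bsub>S\<^esub> d)) = ?z"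
        if "a \<in> N" "b' \<in> N" "c \<in> N" "d \<in> N" for a b' c d
        using eq[of "[a, b', c, d]" "[b, b, b, b]"] that b by (simp add: tuples_def)
    qed (use N sg fin in \<open>auto simp: semigroup_on_def\<close>)
    have "card (carrier S) = card N + 1" using N finite_N by simp
    then show ?thesis
      unfolding determined_by_minors_def using term_if_minors by simp
  qed
qed

theorem theorem2p3:
  fixes S :: "('a, 'b) monoid_scheme"
  assumes "nilpotent_monoid 4 S"
    and "finite (carrier S)"
  shows "finitely_related (carrier S) (mult S) \<and>
         degree (carrier S) (mult S) \<le> enat (card (carrier S) + 1)"
proof
  have det: "determined_by_minors (carrier S) (mult S) (card (carrier S) + 1)"
    using assms by (rule determined_by_minors_nilpotent_monoid)
  interpret monoid S using assms(1) by (simp add: nilpotent_monoid_def)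
  have "semigroup_on (carrier S) (mult S)" by (simp add: semigroup_on_def m_assoc)
  then show "finitely_related (carrier S) (mult S)"
    using finitely_related_if_determined_by_minors[OF _ assms(2) _ _ det] by auto
  show "degree (carrier S) (mult S) \<le> enat (card (carrier S) + 1)"
    using det by (auto simp: degree_le_iff)
qed

end
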